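(* Let $K$ be a knot in $\mathbb{R}^3$ and let $(L_i)_{i\in\mathbb{N}}$ be any sequence of knots in $\mathbb{R}^3$. Then there is a smooth map $f:S^1\to\mathbb{R}^3$ such that $f$ parametrises $K$, for every $n\in\mathbb{N}$ the $n$th derivative $f^{(n)}:S^1\to\mathbb{R}^3$ parametrises a knot $K_n$, and there is a strictly monotone increasing sequence $(n_i)_{i\in\mathbb{N}}$ of natural numbers such that $K_{n_i}$ is ambient isotopic to $L_i$ for all $i\in\mathbb{N}$.
   Context: $\mathbb{N}=\{1,2,3,\ldots\}$ and $S^1\cong\mathbb{R}/2\pi\mathbb{Z}$. For a smooth map $f=(x,y,z):S^1\to\mathbb{R}^3$, $f^{(n)}=(x^{(n)},y^{(n)},z^{(n)})$ denotes the $n$th derivative with respect to the variable $t\in\mathbb{R}/2\pi\mathbb{Z}$. All knots are smooth knots in $\mathbb{R}^3$: a knot is the image of a smooth embedding $S^1\to\mathbb{R}^3$, i.e. of an injective smooth map with nowhere vanishing derivative. A smooth map $h:S^1\to\mathbb{R}^3$ "parametrises a knot" if it is such an embedding (in particular $h$ itself must be injective; it is not enough that its image is a knot). It "parametrises $K$" if moreover its image is ambient isotopic in $\mathbb{R}^3$ to $K$. *)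

theory Defs
  imports "HOL-Analysis.Analysis"
begin

text \<open>
  Smoothness on an open set. On a finite-dimensional domain, being of class \<open>C\<^bsup>k+1\<^esup>\<close> means being
  differentiable with all directional derivatives of class \<open>C\<^sup>k\<close>.
\<close>

primrec Ck_on :: "nat \<Rightarrow> ('a::euclidean_space \<Rightarrow> 'b::euclidean_space) \<Rightarrow> 'a set \<Rightarrow> bool" where
  "Ck_on 0 f S \<longleftrightarrow> continuous_on S f"
| "Ck_on (Suc k) f S \<longleftrightarrow>
     (\<forall>x\<in>S. f differentiable (at x)) \<and>
     (\<forall>v. Ck_on k (\<lambda>x. frechet_derivative f (at x) v) S)"

definition smooth_on :: "('a::euclidean_space \<Rightarrow> 'b::euclidean_space) \<Rightarrow> 'a set \<Rightarrow> bool" where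
  "smooth_on f S \<longleftrightarrow> open S \<and> (\<forall>k. Ck_on k f S)"

definition diffeomorphism :: "('a::euclidean_space \<Rightarrow> 'a) \<Rightarrow> bool" where
  "diffeomorphism h \<longleftrightarrow> bij h \<and> smooth_on h UNIV \<and> smooth_on (inv h) UNIV"

text \<open>
  A map on the circle \<open>\<real>/2\<pi>\<int>\<close> is represented by its \<open>2\<pi>\<close>-periodic lift to \<open>\<real>\<close>;
  its image is then the range of the lift.
\<close>

definition smooth_circle_map :: "(real \<Rightarrow> real^3) \<Rightarrow> bool" where
  "smooth_circle_map f \<longleftrightarrow> (\<forall>t. f (t + 2 * pi) = f t) \<and> smooth_on f UNIV"

definition nth_derivative :: "nat \<Rightarrow> (real \<Rightarrow> real^3) \<Rightarrow> real \<Rightarrow> real^3" where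
  "nth_derivative n f = ((\<lambda>g t. vector_derivative g (at t)) ^^ n) f"

definition parametrises_a_knot :: "(real \<Rightarrow> real^3) \<Rightarrow> bool" where
  "parametrises_a_knot f \<longleftrightarrow>
     smooth_circle_map f \<and> inj_on f {0..<2 * pi} \<and> (\<forall>t. vector_derivative f (at t) \<noteq> 0)"

definition is_knot :: "(real^3) set \<Rightarrow> bool" where
  "is_knot K \<longleftrightarrow> (\<exists>f. parametrises_a_knot f \<and> K = range f)"

text \<open>
  Ambient isotopy in the smooth category: a smooth family of diffeomorphisms of \<open>\<real>\<^sup>3\<close>, with
  parameter in \<open>[0,1]\<close>, starting at the identity. Smoothness on \<open>[0,1] \<times> \<real>\<^sup>3\<close>, a manifold with
  boundary, means smoothness on an open neighbourhood; nothing else is required of \<open>H t\<close> for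
  \<open>t\<close> outside \<open>[0,1]\<close>.
\<close>

definition ambient_isotopic :: "(real^3) set \<Rightarrow> (real^3) set \<Rightarrow> bool" where
  "ambient_isotopic K L \<longleftrightarrow>
     (\<exists>H :: real \<Rightarrow> real^3 \<Rightarrow> real^3.
        (\<exists>U. {0..1} \<times> UNIV \<subseteq> U \<and> smooth_on (\<lambda>(t, x). H t x) U) \<and>
        (\<forall>t\<in>{0..1}. diffeomorphism (H t)) \<and>
        H 0 = id \<and> H 1 ` K = L)"

definition parametrises :: "(real \<Rightarrow> real^3) \<Rightarrow> (real^3) set \<Rightarrow> bool" where
  "parametrises f K \<longleftrightarrow> parametrises_a_knot f \<and> ambient_isotopic (range f) K"

end

theory Submission
  imports Defs
begin

text \<open>
  The construction gives type \<open>L i\<close> to the derivative of order \<open>2 i\<close>. The map \<open>f\<close> is the limit of a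
  sequence of smooth loops, where each loop realises one more of the types and the corrections shrink so quickly that nothing
  achieved is lost in the limit (\<open>stably_realises_step\<close>, \<open>limit_of_close_loops\<close>).

  The reason why one can prescribe the type of a derivative without disturbing the lower ones is
  that every knot type is dense in the mean (\<open>knot_L1_approximation\<close>). For any loop \<open>\<gamma>\<close>, take many
  points close to \<open>\<gamma>\<close>. Shears of space, which are isotopic to the identity, move a knot of the wanted
  type through these points in the right order (\<open>knot_through_points\<close>), and a parametrisation that
  rests at the points and hurries between them is close to \<open>\<gamma>\<close> in the mean. If \<open>\<gamma>\<close> is a derivative
  of \<open>f\<close> of order \<open>n + 1\<close>, replacing it by this knot changes \<open>f\<close> and its derivatives up to order \<open>n\<close>
  only by a little, uniformly. This leaves knots of order below \<open>n\<close> intact: their velocities change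
  little, and the type of a knot is stable under such changes (\<open>knot_type_stable\<close>). The derivative
  of order \<open>n\<close> might fail to be an embedding, because its velocity is the replaced derivative; this
  is repaired by adding \<open>a cos t + b sin t\<close> with generic small vectors \<open>a, b\<close>
  (\<open>knot_generic_perturbation\<close>), which is equally small in derivatives of all orders. So two orders of
  differentiation are spent on each type.

  Stability of the type comes from splitting a perturbation into motions in the three coordinate
  directions. A function on an embedded circle extends to a smooth function \<open>D\<close> on space
  (\<open>knot_extension\<close>), and \<open>x \<mapsto> x + h D(x) e\<close> is, for small \<open>h\<close>, a
  diffeomorphism isotopic to the identity, whose inverse is controlled by a one-dimensional argument
  (\<open>diffeomorphism_directional_move\<close>). Thus the type is locally constant along the motion.
\<close>

section \<open>Calculus of smooth maps\<close>

lemma Ck_on_has_derivative: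
  assumes "Ck_on (Suc k) f S" "x \<in> S"
  shows "(f has_derivative frechet_derivative f (at x)) (at x)"
  using assms by (simp add: frechet_derivative_works)

text \<open>Any formula for the derivative on \<open>S\<close> will do, since membership in \<open>C\<^sup>k\<close> depends only on the
  values on the open set \<open>S\<close>.\<close>

lemma Ck_on_SucI:
  assumes "\<And>x. x \<in> S \<Longrightarrow> (f has_derivative f' x) (at x)" and "\<And>v. Ck_on k (\<lambda>x. f' x v) S" and "open S"
  shows "Ck_on (Suc k) f S"
proof -
  have eq: "frechet_derivative f (at x) = f' x" if "x \<in> S" for x
    using frechet_derivative_at[OF assms(1)[OF that]] by simp
  have cong: "Ck_on k h S" if "Ck_on k g S" "\<And>x. x \<in> S \<Longrightarrow> g x = h x"
    for k and g h :: "'a \<Rightarrow> 'b"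
    using that
  proof (induction k arbitrary: g h)
    case 0
    then show ?case by (simp cong: continuous_on_cong)
  next
    case (Suc k)
    have d: "(h has_derivative frechet_derivative g (at x)) (at x)" if "x \<in> S" for x
      by (rule has_derivative_transform_within_open[OF Ck_on_has_derivative[OF Suc.prems(1) that] \<open>open S\<close> that])
        (simp add: Suc.prems)
    have "frechet_derivative h (at x) = frechet_derivative g (at x)" if "x \<in> S" for x
      using frechet_derivative_at[OF d[OF that]] by simp
    moreover have "h differentiable (at x)" if "x \<in> S" for x
      using d[OF that] differentiable_def by blast
    moreover have "Ck_on k (\<lambda>x. frechet_derivative g (at x) v) S" for v
      using Suc.prems(1) by simp
    ultimately show ?case
      using Suc.IH[of "\<lambda>x. frechet_derivative g (at x) v" "\<lambda>x. frechet_derivative h (at x) v" for v] by simp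
  qed
  show ?thesis
    using assms(1) cong[OF assms(2), of v "\<lambda>x. frechet_derivative f (at x) v" for v] eq
    by (auto intro: differentiableI)
qed

lemma Ck_on_cong:
  assumes "Ck_on k f S" "open S" "\<And>x. x \<in> S \<Longrightarrow> f x = g x"
  shows "Ck_on k g S"
proof (cases k)
  case 0
  then show ?thesis using assms by (simp cong: continuous_on_cong)
next
  case (Suc m)
  show ?thesis unfolding Suc
  proof (rule Ck_on_SucI[OF _ _ \<open>open S\<close>])
    show "(g has_derivative frechet_derivative f (at x)) (at x)" if "x \<in> S" for x
      by (rule has_derivative_transform_within_open[OF Ck_on_has_derivative \<open>open S\<close> that])
        (use assms Suc that in auto)
    show "Ck_on m (\<lambda>x. frechet_derivative f (at x) v) S" for v
      using assms(1) Suc by simp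
  qed
qed

lemma Ck_on_Suc_imp: "Ck_on (Suc k) f S \<Longrightarrow> Ck_on k f S"
proof (induction k arbitrary: f)
  case 0
  then show ?case
    by (auto simp: differentiable_imp_continuous_within continuous_at_imp_continuous_on)
next
  case (Suc k)
  then have "\<forall>v. Ck_on (Suc k) (\<lambda>x. frechet_derivative f (at x) v) S"
    unfolding Ck_on.simps(2)[of "Suc k"] by blast
  with Suc have "Ck_on k (\<lambda>x. frechet_derivative f (at x) v) S" for v
    by blast
  with Suc.prems show ?case unfolding Ck_on.simps(2)[of k] Ck_on.simps(2)[of "Suc k"] by blast
qed

lemma Ck_on_subset: "Ck_on k f S \<Longrightarrow> T \<subseteq> S \<Longrightarrow> Ck_on k f T"
  by (induction k arbitrary: f) (auto intro: continuous_on_subset)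

lemma Ck_on_local:
  assumes "\<And>x. x \<in> S \<Longrightarrow> \<exists>U. open U \<and> x \<in> U \<and> Ck_on k f U"
  shows "Ck_on k f S"
  using assms
proof (induction k arbitrary: f)
  case 0
  have "continuous (at x) f" if x: "x \<in> S" for x
  proof -
    obtain U where "open U" "x \<in> U" "continuous_on U f" using 0[OF x] by auto
    then show ?thesis by (simp add: continuous_on_eq_continuous_at)
  qed
  then show ?case by (simp add: continuous_at_imp_continuous_on)
next
  case (Suc k)
  have "f differentiable (at x)" if x: "x \<in> S" for x
    using Suc.prems[OF x] by auto
  moreover have "Ck_on k (\<lambda>x. frechet_derivative f (at x) v) S" for v
    by (rule Suc.IH) (metis Suc.prems Ck_on.simps(2))
  ultimately show ?case by simp
qed

lemma Ck_on_const: "open S \<Longrightarrow> Ck_on k (\<lambda>x. c) S"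
proof (induction k arbitrary: c)
  case (Suc k)
  show ?case
    by (rule Ck_on_SucI[where f' = "\<lambda>x v. 0"]) (use Suc in auto)
qed simp

lemma Ck_on_linear:
  assumes "bounded_linear f" "open S" shows "Ck_on k f S"
proof (cases k)
  case 0
  then show ?thesis using assms by (simp add: linear_continuous_on)
next
  case (Suc m)
  then show ?thesis
    using assms by (auto intro!: Ck_on_SucI[where f' = "\<lambda>x. f"] Ck_on_const bounded_linear_imp_has_derivative simp del: Ck_on.simps)
qed

lemma Ck_on_add:
  "open S \<Longrightarrow> Ck_on k f S \<Longrightarrow> Ck_on k g S \<Longrightarrow> Ck_on k (\<lambda>x. f x + g x) S"
proof (induction k arbitrary: f g)
  case (Suc k)
  show ?case
  proof (rule Ck_on_SucI[OF _ _ \<open>open S\<close>])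
    show "((\<lambda>x. f x + g x) has_derivative
        (\<lambda>v. frechet_derivative f (at x) v + frechet_derivative g (at x) v)) (at x)" if "x \<in> S" for x
      using Ck_on_has_derivative[OF Suc.prems(2) that] Ck_on_has_derivative[OF Suc.prems(3) that]
      by (rule has_derivative_add)
    show "Ck_on k (\<lambda>x. frechet_derivative f (at x) v + frechet_derivative g (at x) v) S" for v
      using Suc by simp
  qed
qed (auto intro: continuous_on_add)

lemma Ck_on_bilinear:
  assumes "bounded_bilinear mul" "open S"
  shows "Ck_on k f S \<Longrightarrow> Ck_on k g S \<Longrightarrow> Ck_on k (\<lambda>x. mul (f x) (g x)) S"
proof (induction k arbitrary: f g)
  case 0
  then show ?case using bounded_bilinear.continuous_on[OF assms(1)] by simp
next
  case (Suc k)
  show ?case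
  proof (rule Ck_on_SucI[OF _ _ \<open>open S\<close>])
    show "((\<lambda>x. mul (f x) (g x)) has_derivative
        (\<lambda>v. mul (f x) (frechet_derivative g (at x) v) + mul (frechet_derivative f (at x) v) (g x))) (at x)"
      if "x \<in> S" for x
      using Ck_on_has_derivative[OF Suc.prems(1) that] Ck_on_has_derivative[OF Suc.prems(2) that]
      by (rule bounded_bilinear.FDERIV[OF assms(1)])
    show "Ck_on k (\<lambda>x. mul (f x) (frechet_derivative g (at x) v) + mul (frechet_derivative f (at x) v) (g x)) S" for v
      using Suc.prems by (intro Ck_on_add Suc.IH \<open>open S\<close> Ck_on_Suc_imp[OF Suc.prems(1)] Ck_on_Suc_imp[OF Suc.prems(2)]) simp_all
  qed
qed

lemma Ck_on_sum:
  assumes "open S" "\<And>i. i \<in> I \<Longrightarrow> Ck_on k (f i) S"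
  shows "Ck_on k (\<lambda>x. \<Sum>i\<in>I. f i x) S"
  using assms(2) by (induction I rule: infinite_finite_induct) (auto intro: Ck_on_const Ck_on_add assms(1))

text \<open>The chain rule gives \<open>D(g \<circ> f)(x) v\<close> as a sum over a basis of products of components of
  \<open>Df(x) v\<close> with partial derivatives of \<open>g\<close> at \<open>f x\<close>; these are again composites, of one order
  less, so that induction on the order applies.\<close>

lemma Ck_on_compose:
  fixes f :: "'a::euclidean_space \<Rightarrow> 'b::euclidean_space" and g :: "'b \<Rightarrow> 'c::euclidean_space"
  assumes "open S" "open T" "f ` S \<subseteq> T"
  shows "Ck_on k g T \<Longrightarrow> Ck_on k f S \<Longrightarrow> Ck_on k (\<lambda>x. g (f x)) S"
proof (induction k arbitrary: g)
  case 0
  then show ?case using assms(3) by (auto intro: continuous_on_compose2)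
next
  case (Suc k)
  show ?case
  proof (rule Ck_on_SucI[OF _ _ \<open>open S\<close>])
    show "((\<lambda>x. g (f x)) has_derivative
        (\<lambda>v. \<Sum>b\<in>Basis. (frechet_derivative f (at x) v \<bullet> b) *\<^sub>R frechet_derivative g (at (f x)) b)) (at x)"
      if "x \<in> S" for x
    proof -
      have g: "(g has_derivative frechet_derivative g (at (f x))) (at (f x))"
        using that assms(3) by (intro Ck_on_has_derivative[OF Suc.prems(1)]) auto
      have lin: "linear (frechet_derivative g (at (f x)))"
        using g has_derivative_linear by blast
      have "frechet_derivative g (at (f x)) w
          = (\<Sum>b\<in>Basis. (w \<bullet> b) *\<^sub>R frechet_derivative g (at (f x)) b)" for w
        by (subst euclidean_representation[of w, symmetric])
          (simp add: linear_sum[OF lin] linear_scale[OF lin])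
      then show ?thesis
        by (intro has_derivative_eq_rhs[OF has_derivative_compose[OF Ck_on_has_derivative[OF Suc.prems(2) that] g]] ext)
    qed
    show "Ck_on k (\<lambda>x. \<Sum>b\<in>Basis. (frechet_derivative f (at x) v \<bullet> b) *\<^sub>R frechet_derivative g (at (f x)) b) S" for v
    proof (intro Ck_on_sum \<open>open S\<close> Ck_on_bilinear[OF bounded_bilinear_scaleR])
      fix b :: 'b
      show "Ck_on k (\<lambda>x. frechet_derivative f (at x) v \<bullet> b) S"
        using Suc.prems(2) by (intro Ck_on_bilinear[OF bounded_bilinear_inner] \<open>open S\<close> Ck_on_const) auto
      show "Ck_on k (\<lambda>x. frechet_derivative g (at (f x)) b) S"
        using Suc.prems(1) by (intro Suc.IH Ck_on_Suc_imp[OF Suc.prems(2)]) auto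
    qed
  qed
qed

text \<open>This suits functions whose derivatives of all orders stay in an explicitly known family, such as
  the combinations of sine and cosine.\<close>

lemma smooth_on_coinduct:
  assumes "open S" "F f"
    and "\<And>f. F f \<Longrightarrow> \<exists>f'. (\<forall>x\<in>S. (f has_derivative f' x) (at x)) \<and> (\<forall>v. F (\<lambda>x. f' x v))"
  shows "smooth_on f S"
proof -
  have "Ck_on k f S" if "F f" for k f
    using that
  proof (induction k arbitrary: f)
    case 0
    then show ?case
      using assms(3) has_derivative_continuous continuous_at_imp_continuous_on by (metis Ck_on.simps(1))
  next
    case (Suc k)
    obtain f' where "\<forall>x\<in>S. (f has_derivative f' x) (at x)" "\<forall>v. F (\<lambda>x. f' x v)"
      using assms(3)[OF Suc.prems] by blast
    then show ?case using Suc.IH \<open>open S\<close> by (intro Ck_on_SucI) auto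
  qed
  then show ?thesis using assms by (simp add: smooth_on_def)
qed

lemma smooth_on_open: "smooth_on f S \<Longrightarrow> open S"
  by (simp add: smooth_on_def)

named_theorems smooth_intros

lemma smooth_on_const [smooth_intros]: "open S \<Longrightarrow> smooth_on (\<lambda>x. c) S"
  by (simp add: smooth_on_def Ck_on_const)

lemma smooth_on_linear: "bounded_linear f \<Longrightarrow> open S \<Longrightarrow> smooth_on f S"
  by (simp add: smooth_on_def Ck_on_linear)

lemma smooth_on_id [smooth_intros]: "open S \<Longrightarrow> smooth_on (\<lambda>x. x) S"
  by (simp add: smooth_on_linear bounded_linear_ident)

lemma smooth_on_add [smooth_intros]: "smooth_on f S \<Longrightarrow> smooth_on g S \<Longrightarrow> smooth_on (\<lambda>x. f x + g x) S"
  by (simp add: smooth_on_def Ck_on_add)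

lemma smooth_on_sum [smooth_intros]:
  "open S \<Longrightarrow> (\<And>i. i \<in> I \<Longrightarrow> smooth_on (f i) S) \<Longrightarrow> smooth_on (\<lambda>x. \<Sum>i\<in>I. f i x) S"
  by (simp add: smooth_on_def Ck_on_sum)

lemma smooth_on_scaleR [smooth_intros]:
  "smooth_on f S \<Longrightarrow> smooth_on g S \<Longrightarrow> smooth_on (\<lambda>x. f x *\<^sub>R g x) S"
  by (simp add: smooth_on_def Ck_on_bilinear[OF bounded_bilinear_scaleR])

lemma smooth_on_mult [smooth_intros]:
  fixes f g :: "'a::euclidean_space \<Rightarrow> real"
  shows "smooth_on f S \<Longrightarrow> smooth_on g S \<Longrightarrow> smooth_on (\<lambda>x. f x * g x) S"
  by (simp add: smooth_on_def Ck_on_bilinear[OF bounded_bilinear_mult])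

lemma smooth_on_inner [smooth_intros]:
  "smooth_on f S \<Longrightarrow> smooth_on g S \<Longrightarrow> smooth_on (\<lambda>x. f x \<bullet> g x) S"
  by (simp add: smooth_on_def Ck_on_bilinear[OF bounded_bilinear_inner])

lemma smooth_on_compose:
  "smooth_on g T \<Longrightarrow> smooth_on f S \<Longrightarrow> f ` S \<subseteq> T \<Longrightarrow> smooth_on (\<lambda>x. g (f x)) S"
  unfolding smooth_on_def using Ck_on_compose by metis

lemma smooth_on_linear_compose:
  "bounded_linear g \<Longrightarrow> smooth_on f S \<Longrightarrow> smooth_on (\<lambda>x. g (f x)) S"
  using smooth_on_compose[OF smooth_on_linear] open_UNIV by blast

lemma smooth_on_minus [smooth_intros]: "smooth_on f S \<Longrightarrow> smooth_on (\<lambda>x. - f x) S"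
  by (rule smooth_on_linear_compose) (auto intro: bounded_linear_minus bounded_linear_ident)

lemma smooth_on_diff [smooth_intros]: "smooth_on f S \<Longrightarrow> smooth_on g S \<Longrightarrow> smooth_on (\<lambda>x. f x - g x) S"
  using smooth_on_add[of f S "\<lambda>x. - g x"] smooth_on_minus by auto

lemma smooth_on_fst [smooth_intros]: "smooth_on f S \<Longrightarrow> smooth_on (\<lambda>x. fst (f x)) S"
  by (rule smooth_on_linear_compose[OF bounded_linear_fst])

lemma smooth_on_snd [smooth_intros]: "smooth_on f S \<Longrightarrow> smooth_on (\<lambda>x. snd (f x)) S"
  by (rule smooth_on_linear_compose[OF bounded_linear_snd])

lemma smooth_on_Pair [smooth_intros]:
  assumes "smooth_on f S" "smooth_on g S" shows "smooth_on (\<lambda>x. (f x, g x)) S"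
proof -
  have "bounded_linear (\<lambda>x. (x, 0))" "bounded_linear (\<lambda>y. (0, y))"
    by (intro bounded_linear_Pair bounded_linear_ident bounded_linear_zero)+
  from smooth_on_add[OF smooth_on_linear_compose[OF this(1) assms(1)] smooth_on_linear_compose[OF this(2) assms(2)]]
  show ?thesis by simp
qed

lemma smooth_on_cong: "smooth_on f S \<Longrightarrow> (\<And>x. x \<in> S \<Longrightarrow> f x = g x) \<Longrightarrow> smooth_on g S"
  unfolding smooth_on_def using Ck_on_cong by blast

lemma smooth_on_subset: "smooth_on f S \<Longrightarrow> open T \<Longrightarrow> T \<subseteq> S \<Longrightarrow> smooth_on f T"
  unfolding smooth_on_def using Ck_on_subset by blast

lemma smooth_on_local:
  assumes "open S" "\<And>x. x \<in> S \<Longrightarrow> \<exists>U. x \<in> U \<and> smooth_on f U"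
  shows "smooth_on f S"
  unfolding smooth_on_def using assms Ck_on_local by (metis smooth_on_def)

lemma smooth_on_has_derivative:
  "smooth_on f S \<Longrightarrow> x \<in> S \<Longrightarrow> (f has_derivative frechet_derivative f (at x)) (at x)"
  unfolding smooth_on_def using Ck_on_has_derivative by blast

lemma smooth_on_frechet_derivative: "smooth_on f S \<Longrightarrow> smooth_on (\<lambda>x. frechet_derivative f (at x) v) S"
  unfolding smooth_on_def using Ck_on.simps(2) by blast

lemma smooth_on_imp_continuous_on: "smooth_on f S \<Longrightarrow> continuous_on S f"
  unfolding smooth_on_def by (meson Ck_on.simps(1))

lemma smooth_on_has_vector_derivative:
  fixes f :: "real \<Rightarrow> 'a::euclidean_space"
  shows "smooth_on f S \<Longrightarrow> x \<in> S \<Longrightarrow> (f has_vector_derivative vector_derivative f (at x)) (at x)"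
  using smooth_on_has_derivative vector_derivative_works differentiable_def by blast

lemma smooth_on_vector_derivative:
  fixes f :: "real \<Rightarrow> 'a::euclidean_space"
  assumes "smooth_on f S"
  shows "smooth_on (\<lambda>x. vector_derivative f (at x)) S"
proof (rule smooth_on_cong[OF smooth_on_frechet_derivative[OF assms, of 1]])
  fix x assume "x \<in> S"
  then have "(f has_derivative (\<lambda>v. v *\<^sub>R vector_derivative f (at x))) (at x)"
    using smooth_on_has_vector_derivative[OF assms] by (simp add: has_vector_derivative_def)
  then show "frechet_derivative f (at x) 1 = vector_derivative f (at x)"
    using frechet_derivative_at by (metis scaleR_one)
qed

lemma smooth_on_from_vector_derivative:
  fixes f :: "real \<Rightarrow> 'a::euclidean_space"
  assumes "\<And>x. x \<in> S \<Longrightarrow> (f has_vector_derivative f' x) (at x)" "smooth_on f' S"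
  shows "smooth_on f S"
proof -
  have S: "open S" using assms(2) by (rule smooth_on_open)
  have "Ck_on (Suc k) f S" for k
  proof (rule Ck_on_SucI[OF _ _ S])
    show "(f has_derivative (\<lambda>v. v *\<^sub>R f' x)) (at x)" if "x \<in> S" for x
      using assms(1)[OF that] by (simp add: has_vector_derivative_def)
    show "Ck_on k (\<lambda>x. v *\<^sub>R f' x) S" for v
      using assms(2) unfolding smooth_on_def
      by (intro Ck_on_bilinear[OF bounded_bilinear_scaleR] Ck_on_const) auto
  qed
  then show ?thesis using S Ck_on_Suc_imp smooth_on_def by blast
qed

lemma smooth_on_real_inverse: "smooth_on (inverse :: real \<Rightarrow> real) (- {0})"
proof -
  have "Ck_on k (inverse :: real \<Rightarrow> real) (- {0})" for k
  proof (induction k)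
    case (Suc k)
    show ?case
    proof (rule Ck_on_SucI)
      show "(inverse has_derivative (\<lambda>v. - (inverse x * inverse x) * v)) (at x)" if "x \<in> - {0}" for x :: real
        using that by (auto intro!: derivative_eq_intros)
      have "Ck_on k (\<lambda>x. (- v) * (inverse x * inverse x)) (- {0})" for v :: real
        by (intro Ck_on_bilinear[OF bounded_bilinear_mult] Ck_on_const Suc) auto
      then show "Ck_on k (\<lambda>x. - (inverse x * inverse x) * v) (- {0})" for v :: real
        by (simp add: mult.commute)
    qed auto
  qed (auto intro: continuous_intros)
  then show ?thesis by (auto simp: smooth_on_def)
qed

lemma smooth_on_divide [smooth_intros]:
  fixes f g :: "'a::euclidean_space \<Rightarrow> real"
  assumes "smooth_on f S" "smooth_on g S" "\<And>x. x \<in> S \<Longrightarrow> g x \<noteq> 0"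
  shows "smooth_on (\<lambda>x. f x / g x) S"
proof -
  have "smooth_on (\<lambda>x. inverse (g x)) S"
    using assms(3) by (intro smooth_on_compose[OF smooth_on_real_inverse assms(2)]) auto
  from smooth_on_mult[OF assms(1) this] show ?thesis by (simp add: divide_inverse)
qed

lemma smooth_on_cos_sin: "smooth_on (\<lambda>x::real. a * cos x + b * sin x) UNIV"
proof (rule smooth_on_coinduct[where F = "\<lambda>f. \<exists>a b. \<forall>x. f x = a * cos x + b * sin x"])
  fix f :: "real \<Rightarrow> real"
  assume "\<exists>a b. \<forall>x. f x = a * cos x + b * sin x"
  then obtain a b where f: "f = (\<lambda>x. a * cos x + b * sin x)" by blast
  have "(f has_derivative (\<lambda>v. (v * b) * cos x + (- v * a) * sin x)) (at x)" for x
    unfolding f by (auto intro!: derivative_eq_intros simp: algebra_simps)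
  then show "\<exists>f'. (\<forall>x\<in>UNIV. (f has_derivative f' x) (at x)) \<and>
      (\<forall>v. \<exists>a b. \<forall>x. f' x v = a * cos x + b * sin x)"
    by (intro exI[of _ "\<lambda>x v. (v * b) * cos x + (- v * a) * sin x"] conjI ballI allI) blast+
qed auto

lemma smooth_on_cos [smooth_intros]: "smooth_on f S \<Longrightarrow> smooth_on (\<lambda>x. cos (f x :: real)) S"
  using smooth_on_compose[OF smooth_on_cos_sin[of 1 0]] by simp

lemma smooth_on_sin [smooth_intros]: "smooth_on f S \<Longrightarrow> smooth_on (\<lambda>x. sin (f x :: real)) S"
  using smooth_on_compose[OF smooth_on_cos_sin[of 0 1]] by simp

lemma smooth_on_arctan [smooth_intros]:
  assumes "smooth_on f S" shows "smooth_on (\<lambda>x. arctan (f x)) S"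
proof -
  have "smooth_on arctan UNIV"
  proof (rule smooth_on_from_vector_derivative)
    show "(arctan has_vector_derivative 1 / (1 + x * x)) (at x)" for x
      using DERIV_arctan[of x]
      by (simp add: has_real_derivative_iff_has_vector_derivative power2_eq_square inverse_eq_divide)
    show "smooth_on (\<lambda>x::real. 1 / (1 + x * x)) UNIV"
      by (intro smooth_intros) (auto simp: add_nonneg_eq_0_iff)
  qed
  then show ?thesis using smooth_on_compose assms by blast
qed

text \<open>The functions \<open>x\<^sup>-\<^sup>n exp (-1/x)\<close>, extended by \<open>0\<close> to \<open>x \<le> 0\<close>, are flat at the origin, and
  their derivatives are combinations of functions of the same shape.\<close>

definition flat :: "nat \<Rightarrow> real \<Rightarrow> real" where
  "flat n x = (if x > 0 then inverse x ^ n / exp (inverse x) else 0)"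

lemma flat_tendsto_0: "(flat n \<longlongrightarrow> 0) (at 0)"
proof (rule filterlim_split_at)
  show "(flat n \<longlongrightarrow> 0) (at_left 0)"
    by (rule tendsto_eventually) (auto simp: eventually_at_filter flat_def)
  have "((\<lambda>x. inverse x ^ n / exp (inverse x)) \<longlongrightarrow> (0::real)) (at_right 0)"
    by (rule filterlim_compose[OF tendsto_power_div_exp_0 filterlim_inverse_at_top_right])
  then show "(flat n \<longlongrightarrow> 0) (at_right 0)"
    by (rule Lim_transform_eventually) (auto simp: eventually_at_filter flat_def)
qed

lemma flat_has_derivative:
  "(flat n has_real_derivative (flat (n + 2) x - real n * flat (Suc n) x)) (at x)"
proof (cases x "0::real" rule: linorder_cases)
  case less
  have "((\<lambda>x. 0) has_real_derivative (flat (n + 2) x - real n * flat (Suc n) x)) (at x)"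
    using less by (simp add: flat_def)
  then show ?thesis
    by (rule has_field_derivative_transform_within_open[where S = "{..<0}"]) (use less in \<open>auto simp: flat_def\<close>)
next
  case equal
  have "((\<lambda>y. (flat n y - flat n 0) / (y - 0)) \<longlongrightarrow> 0) (at 0)"
    by (rule Lim_transform_eventually[OF flat_tendsto_0[of "Suc n"]])
      (auto simp: eventually_at_filter flat_def field_simps)
  then show ?thesis
    using equal by (simp add: has_field_derivative_iff) (simp add: flat_def)
next
  case greater
  have "((\<lambda>x. inverse x ^ n * exp (- inverse x)) has_real_derivative
      (flat (n + 2) x - real n * flat (Suc n) x)) (at x)"
  proof -
    have "inverse x ^ n = inverse x ^ (n - 1) * inverse x" if "n > 0"
      using that by (metis power_minus_mult)
    then show ?thesis
      using greater
      by (cases "n = 0") (auto intro!: derivative_eq_intros simp: flat_def exp_minus divide_inverse algebra_simps)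
  qed
  then have "((\<lambda>x. inverse x ^ n / exp (inverse x)) has_real_derivative
      (flat (n + 2) x - real n * flat (Suc n) x)) (at x)"
    by (simp add: exp_minus divide_inverse)
  then show ?thesis
    by (rule has_field_derivative_transform_within_open[where S = "{0<..}"]) (use greater in \<open>auto simp: flat_def\<close>)
qed

lemma smooth_on_flat: "smooth_on (flat n) UNIV"
proof -
  have "Ck_on k (flat n) UNIV" for k
  proof (induction k arbitrary: n)
    case 0
    then show ?case
      using flat_has_derivative DERIV_continuous continuous_at_imp_continuous_on by (metis Ck_on.simps(1))
  next
    case (Suc k)
    show ?case
    proof (rule Ck_on_SucI)
      show "(flat n has_derivative (\<lambda>v. (flat (n + 2) x + (- real n) * flat (Suc n) x) * v)) (at x)" for x
        using flat_has_derivative[of n x] by (simp add: has_field_derivative_def)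
      show "Ck_on k (\<lambda>x. (flat (n + 2) x + (- real n) * flat (Suc n) x) * v) UNIV" for v
        by (intro Ck_on_add Ck_on_bilinear[OF bounded_bilinear_mult] Ck_on_const Suc) auto
    qed auto
  qed
  then show ?thesis by (simp add: smooth_on_def)
qed

definition bump :: "real \<Rightarrow> real" where
  "bump = flat 0"

lemma bump_pos_iff: "bump x > 0 \<longleftrightarrow> x > 0"
  and bump_nonneg: "bump x \<ge> 0"
  and bump_eq_0: "x \<le> 0 \<Longrightarrow> bump x = 0"
  by (auto simp: bump_def flat_def)

lemma smooth_on_bump [smooth_intros]: "smooth_on f S \<Longrightarrow> smooth_on (\<lambda>x. bump (f x)) S"
  using smooth_on_compose[OF smooth_on_flat] by (simp add: bump_def)

section \<open>Ambient isotopy as an equivalence relation\<close>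

lemma diffeomorphism_compose:
  assumes "diffeomorphism f" "diffeomorphism g" shows "diffeomorphism (\<lambda>x. g (f x))"
proof -
  have "inv (g \<circ> f) = inv f \<circ> inv g"
    using assms o_inv_distrib unfolding diffeomorphism_def by blast
  moreover have "smooth_on (\<lambda>x. g (f x)) UNIV" "smooth_on (\<lambda>x. inv f (inv g x)) UNIV"
    using assms by (auto simp: diffeomorphism_def intro: smooth_on_compose)
  ultimately show ?thesis
    using assms bij_comp[of f g] by (auto simp: diffeomorphism_def comp_def)
qed

lemma ambient_isotopicE:
  assumes "ambient_isotopic K L"
  obtains U and H :: "real \<Rightarrow> real^3 \<Rightarrow> real^3" where "{0..1} \<times> UNIV \<subseteq> U" "smooth_on (\<lambda>(t, x). H t x) U"
    "\<forall>t\<in>{0..1}. diffeomorphism (H t)" "H 0 = id" "H 1 ` K = L"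
  using assms unfolding ambient_isotopic_def by blast

lemma diffeomorphism_inv: "diffeomorphism f \<Longrightarrow> diffeomorphism (inv f)"
  by (simp add: diffeomorphism_def bij_imp_bij_inv inv_inv_eq)

lemma ambient_isotopic_refl: "ambient_isotopic K K"
proof -
  have "diffeomorphism (\<lambda>x::real^3. x)"
    using inv_id bij_id by (auto simp: diffeomorphism_def id_def intro: smooth_on_id)
  moreover have "smooth_on (\<lambda>(t, x). x) (UNIV :: (real \<times> (real^3)) set)"
    unfolding case_prod_beta by (intro smooth_intros) auto
  ultimately show ?thesis
    unfolding ambient_isotopic_def
    by (intro exI[of _ "\<lambda>t x. x"] conjI exI[of _ UNIV]) (auto simp: id_def)
qed

text \<open>Composing the two isotopies at equal times, instead of running one after the other, keeps the
  dependence on time smooth.\<close>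

lemma ambient_isotopic_trans:
  assumes "ambient_isotopic K L" "ambient_isotopic L M"
  shows "ambient_isotopic K M"
proof -
  obtain U and F :: "real \<Rightarrow> real^3 \<Rightarrow> real^3" where F: "{0..1} \<times> UNIV \<subseteq> U" "smooth_on (\<lambda>(t, x). F t x) U"
    "\<forall>t\<in>{0..1}. diffeomorphism (F t)" "F 0 = id" "F 1 ` K = L"
    by (rule ambient_isotopicE[OF assms(1)])
  obtain V and G :: "real \<Rightarrow> real^3 \<Rightarrow> real^3" where G: "{0..1} \<times> UNIV \<subseteq> V" "smooth_on (\<lambda>(t, x). G t x) V"
    "\<forall>t\<in>{0..1}. diffeomorphism (G t)" "G 0 = id" "G 1 ` L = M"
    by (rule ambient_isotopicE[OF assms(2)])
  define P where "P = (\<lambda>p. (fst p, F (fst p) (snd p)))"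
  define W where "W = U \<inter> P -` V"
  have "smooth_on (\<lambda>p. F (fst p) (snd p)) U"
    using F(2) by (simp add: case_prod_beta')
  then have P: "smooth_on P U"
    unfolding P_def by (intro smooth_intros smooth_on_open[OF F(2)])
  have "open W"
    unfolding W_def
    using continuous_open_preimage[OF smooth_on_imp_continuous_on[OF P]] smooth_on_open[OF F(2)] smooth_on_open[OF G(2)]
    by blast
  then have "smooth_on (\<lambda>p. (\<lambda>(t, x). G t x) (P p)) W"
    using smooth_on_subset[OF P] by (intro smooth_on_compose[OF G(2)]) (auto simp: W_def)
  then have "smooth_on (\<lambda>(t, x). G t (F t x)) W"
    by (simp add: P_def case_prod_beta')
  moreover have "{0..1} \<times> UNIV \<subseteq> W"
    using F(1) G(1) by (auto simp: W_def P_def subset_iff)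
  ultimately show ?thesis
    unfolding ambient_isotopic_def using F(3-) G(3-)
    by (intro exI[of _ "\<lambda>t x. G t (F t x)"] conjI exI[of _ W])
       (auto simp: image_image[symmetric] intro: diffeomorphism_compose)
qed

text \<open>The reversed isotopy \<open>H (1 - t) \<circ> (H 1)\<^sup>-\<^sup>1\<close> inverts only the one diffeomorphism \<open>H 1\<close>, so that
  smoothness in \<open>t\<close> is immediate.\<close>

lemma ambient_isotopic_sym:
  assumes "ambient_isotopic K L"
  shows "ambient_isotopic L K"
proof -
  obtain U and F :: "real \<Rightarrow> real^3 \<Rightarrow> real^3" where F: "{0..1} \<times> UNIV \<subseteq> U" "smooth_on (\<lambda>(t, x). F t x) U"
    "\<forall>t\<in>{0..1}. diffeomorphism (F t)" "F 0 = id" "F 1 ` K = L"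
    by (rule ambient_isotopicE[OF assms(1)])
  have d1: "diffeomorphism (F 1)" using F(3) by simp
  then have s: "smooth_on (inv (F 1)) UNIV" and b: "bij (F 1)" by (auto simp: diffeomorphism_def)
  define P where "P = (\<lambda>p :: real \<times> (real^3). (1 - fst p, inv (F 1) (snd p)))"
  define W where "W = P -` U"
  have P: "smooth_on P UNIV"
    unfolding P_def
    by (intro smooth_intros smooth_on_compose[OF s]) auto
  have "open W"
    unfolding W_def
    using open_vimage[OF smooth_on_open[OF F(2)] smooth_on_imp_continuous_on[OF P]] .
  then have "smooth_on (\<lambda>p. (\<lambda>(t, x). F t x) (P p)) W"
    using smooth_on_subset[OF P] by (intro smooth_on_compose[OF F(2)]) (auto simp: W_def)
  then have "smooth_on (\<lambda>(t, x). F (1 - t) (inv (F 1) x)) W"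
    by (simp add: P_def case_prod_beta')
  moreover have "{0..1} \<times> UNIV \<subseteq> W"
    using F(1) by (auto simp: W_def P_def subset_iff)
  moreover have "diffeomorphism (\<lambda>x. F (1 - t) (inv (F 1) x))" if "t \<in> {0..1}" for t
    using that F(3) by (intro diffeomorphism_compose[OF diffeomorphism_inv[OF d1]]) auto
  moreover have "(\<lambda>x. F (1 - 0) (inv (F 1) x)) = id"
    using b by (auto simp: fun_eq_iff bij_is_surj surj_f_inv_f)
  moreover have "(\<lambda>x. F (1 - 1) (inv (F 1) x)) ` L = K"
    using b F(4,5) by (auto simp: bij_is_inj image_image)
  ultimately show ?thesis
    unfolding ambient_isotopic_def
    by (intro exI[of _ "\<lambda>t x. F (1 - t) (inv (F 1) x)"] conjI exI[of _ W] ballI)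
qed

section \<open>Diffeomorphisms that move points in one direction\<close>

text \<open>If \<open>D\<close> changes slowly in the direction \<open>e\<close>, then \<open>x \<mapsto> x + D x e\<close> maps each line parallel to
  \<open>e\<close> onto itself and has derivative at least \<open>1/2\<close> along it. Only a scalar must be inverted to
  differentiate the inverse, which is therefore smooth by bootstrapping.\<close>

lemma diffeomorphism_directional_move:
  fixes D :: "'a::euclidean_space \<Rightarrow> real"
  assumes D: "smooth_on D UNIV" and small: "\<And>x. \<bar>frechet_derivative D (at x) e\<bar> \<le> 1/2"
  shows "diffeomorphism (\<lambda>x. x + D x *\<^sub>R e)"
proof -
  define H where "H = (\<lambda>x. x + D x *\<^sub>R e)"
  define d where "d = (\<lambda>x v. frechet_derivative D (at x) v)"
  have dD: "(D has_derivative d x) (at x)" for x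
    unfolding d_def using smooth_on_has_derivative[OF D] by simp
  have lin: "linear (d x)" for x
    using dD has_derivative_linear by blast
  have H: "smooth_on H UNIV"
    unfolding H_def by (intro smooth_intros D) auto
  have "\<exists>!x. H x = y" for y
  proof -
    define q where "q = (\<lambda>s. s - D (y - s *\<^sub>R e))"
    have dq: "(q has_real_derivative 1 + d (y - s *\<^sub>R e) e) (at s)" for s
    proof -
      have "((\<lambda>s. D (y - s *\<^sub>R e)) has_derivative (\<lambda>v. d (y - s *\<^sub>R e) (- v *\<^sub>R e))) (at s)"
        by (rule has_derivative_compose[OF _ dD]) (auto intro!: derivative_eq_intros)
      then have "(q has_derivative (\<lambda>v. v - d (y - s *\<^sub>R e) (- v *\<^sub>R e))) (at s)"
        unfolding q_def by (auto intro!: derivative_eq_intros)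
      then show ?thesis
        unfolding has_field_derivative_def
        by (rule has_derivative_eq_rhs)
           (simp add: fun_eq_iff linear_scale[OF lin] linear_neg[OF lin] algebra_simps)
    qed
    have ge: "1/2 \<le> 1 + d x e" for x
      using small[of x] by (simp add: d_def abs_le_iff)
    have mono: "(b - a) / 2 \<le> q b - q a" if "a \<le> b" for a b
    proof (cases "a = b")
      case False
      with that have "a < b" by simp
      then obtain z where "q b - q a = (b - a) * (1 + d (y - z *\<^sub>R e) e)"
        using MVT2[OF \<open>a < b\<close>, of q "\<lambda>s. 1 + d (y - s *\<^sub>R e) e"] dq by blast
      then show ?thesis using mult_left_mono[OF ge[of "y - z *\<^sub>R e"], of "b - a"] \<open>a < b\<close> by simp
    qed simp
    have cont: "continuous_on A q" for A
      by (rule continuous_at_imp_continuous_on) (use DERIV_isCont[OF dq] in blast)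
    define R where "R = 2 * \<bar>q 0\<bar>"
    have "q (- R) \<le> 0" "0 \<le> q R" "- R \<le> R"
      using mono[of "- R" 0] mono[of 0 R] by (auto simp: R_def)
    then obtain s where s: "q s = 0"
      using IVT'[of q "- R" 0 R] cont by blast
    have uniq: "s = s'" if "q s' = 0" for s'
      using mono[of s s'] mono[of s' s] s that by (cases "s \<le> s'") auto
    have "H (y - s *\<^sub>R e) = y"
      using s by (simp add: H_def q_def)
    moreover have "x = y - s *\<^sub>R e" if "H x = y" for x
    proof -
      have "q (D x) = 0" using that by (auto simp: H_def q_def)
      then have "D x = s" using uniq by simp
      then show ?thesis using that by (auto simp: H_def)
    qed
    ultimately show ?thesis by blast
  qed
  then have "bij H" by (simp add: bij_iff)
  define G where "G = inv H"
  have GH: "G (H x) = x" and HG: "H (G x) = x" for x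
    using \<open>bij H\<close> by (auto simp: G_def bij_is_inj bij_is_surj surj_f_inv_f)
  have contG: "continuous_on UNIV G"
    using continuous_on_inverse_open[OF open_UNIV smooth_on_imp_continuous_on[OF H], of G]
      \<open>bij H\<close> GH by (simp add: bij_is_surj)
  define G' where "G' = (\<lambda>x w. w - (d x w / (1 + d x e)) *\<^sub>R e)"
  have dG: "(G has_derivative G' (G y)) (at y)" for y
  proof (rule has_derivative_inverse_basic[of H "\<lambda>v. v + d (G y) v *\<^sub>R e" G y "G' (G y)" UNIV])
    show "(H has_derivative (\<lambda>v. v + d (G y) v *\<^sub>R e)) (at (G y))"
      unfolding H_def by (auto intro!: derivative_eq_intros dD)
    have "bounded_linear (d (G y))" using dD has_derivative_bounded_linear by blast
    then show "bounded_linear (G' (G y))"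
      unfolding G'_def divide_inverse
      by (intro bounded_linear_sub bounded_linear_ident bounded_linear_scaleR_left[THEN bounded_linear_compose]
          bounded_linear_mult_left[THEN bounded_linear_compose])
    have "1 + d (G y) e \<noteq> 0" using small[of "G y"] by (simp add: d_def abs_le_iff)
    then show "G' (G y) \<circ> (\<lambda>v. v + d (G y) v *\<^sub>R e) = id"
      by (auto simp: fun_eq_iff G'_def linear_add[OF lin] linear_scale[OF lin] field_simps simp flip: scaleR_add_left scaleR_diff_left)
    show "continuous (at y) G"
      using contG by (simp add: continuous_on_eq_continuous_at)
  qed (auto simp: HG)
  have "Ck_on k G UNIV" for k
  proof (induction k)
    case 0
    then show ?case using contG by simp
  next
    case (Suc k)
    show ?case
    proof (rule Ck_on_SucI)
      show "(G has_derivative G' (G x)) (at x)" for x by (rule dG)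
      have "Ck_on k (\<lambda>x. G' x v) UNIV" for v
      proof -
        have "1 + d x e \<noteq> 0" for x using small[of x] by (simp add: d_def abs_le_iff)
        moreover have "smooth_on (\<lambda>x. d x w) UNIV" for w
          unfolding d_def by (rule smooth_on_frechet_derivative[OF D])
        ultimately have "smooth_on (\<lambda>x. G' x v) UNIV" unfolding G'_def by (intro smooth_intros) auto
        then show ?thesis by (simp add: smooth_on_def)
      qed
      then show "Ck_on k (\<lambda>x. G' (G x) v) UNIV" for v
        by (rule Ck_on_compose[OF open_UNIV open_UNIV subset_UNIV _ Suc])
    qed auto
  qed
  then show ?thesis
    using \<open>bij H\<close> H unfolding diffeomorphism_def H_def[symmetric] G_def by (simp add: smooth_on_def)
qed

lemma ambient_isotopic_directional_move:
  fixes D :: "real^3 \<Rightarrow> real"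
  assumes D: "smooth_on D UNIV" and small: "\<And>x. \<bar>frechet_derivative D (at x) e\<bar> \<le> 1/2"
  shows "ambient_isotopic K ((\<lambda>x. x + D x *\<^sub>R e) ` K)"
proof -
  have "diffeomorphism (\<lambda>x. x + (t * D x) *\<^sub>R e)" if t: "t \<in> {0..1}" for t
  proof (rule diffeomorphism_directional_move)
    show "smooth_on (\<lambda>x. t * D x) UNIV" by (intro smooth_intros D) auto
    fix x
    have "((\<lambda>x. t * D x) has_derivative (\<lambda>v. t * frechet_derivative D (at x) v)) (at x)"
      by (intro derivative_intros smooth_on_has_derivative[OF D]) auto
    then have "\<bar>frechet_derivative (\<lambda>x. t * D x) (at x) e\<bar> = t * \<bar>frechet_derivative D (at x) e\<bar>"
      using frechet_derivative_at t by (metis abs_mult abs_of_nonneg atLeastAtMost_iff)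
    also have "\<dots> \<le> 1 * (1/2)"
      using t small[of x] by (intro mult_mono) auto
    finally show "\<bar>frechet_derivative (\<lambda>x. t * D x) (at x) e\<bar> \<le> 1/2" by simp
  qed
  moreover have "smooth_on (\<lambda>(t, x). x + (t * D x) *\<^sub>R e) UNIV"
    unfolding case_prod_beta by (intro smooth_intros smooth_on_compose[OF D]) auto
  ultimately show ?thesis
    unfolding ambient_isotopic_def
    by (intro exI[of _ "\<lambda>t x. x + (t * D x) *\<^sub>R e"] conjI exI[of _ UNIV]) (auto simp: id_def)
qed

section \<open>Circle maps and embeddings\<close>

abbreviation velocity :: "(real \<Rightarrow> real^3) \<Rightarrow> real \<Rightarrow> real^3" where
  "velocity f t \<equiv> vector_derivative f (at t)"

lemma periodic_shift_int:
  fixes f :: "real \<Rightarrow> 'a"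
  assumes "\<And>t. f (t + 2 * pi) = f t"
  shows "f (t + 2 * pi * real_of_int k) = f t"
proof -
  have nat: "f (t + 2 * pi * real n) = f t" for t n
  proof (induction n)
    case (Suc n)
    have "f (t + 2 * pi * real (Suc n)) = f ((t + 2 * pi * real n) + 2 * pi)"
      by (simp add: algebra_simps)
    also have "\<dots> = f t" using assms Suc by metis
    finally show ?case .
  qed simp
  show ?thesis
  proof (cases "k \<ge> 0")
    case True
    then show ?thesis using nat[of t "nat k"] by simp
  next
    case False
    then show ?thesis using nat[of "t + 2 * pi * real_of_int k" "nat (- k)"] by (simp add: algebra_simps)
  qed
qed

lemma circle_representative:
  obtains s and k :: int where "s \<in> {0..<2 * pi}" "t = s + 2 * pi * real_of_int k"
proof
  let ?k = "\<lfloor>t / (2 * pi)\<rfloor>"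
  have "real_of_int ?k * (2 * pi) \<le> t" "t < (real_of_int ?k + 1) * (2 * pi)"
    using floor_divide_lower[of "2 * pi" t] floor_divide_upper[of "2 * pi" t] by simp_all
  then show "t - 2 * pi * real_of_int ?k \<in> {0..<2 * pi}"
    by (auto simp: algebra_simps)
qed simp

lemma circle_difference:
  obtains h and k :: int where "\<bar>h\<bar> \<le> pi" "t = s + h + 2 * pi * real_of_int k"
proof -
  obtain u and k :: int where u: "u \<in> {0..<2 * pi}" "t - s + pi = u + 2 * pi * real_of_int k"
    by (rule circle_representative)
  then show thesis
    by (intro that[of "u - pi" k]) auto
qed

lemma smooth_circle_map_smooth: "smooth_circle_map f \<Longrightarrow> smooth_on f UNIV"
  and smooth_circle_map_periodic: "smooth_circle_map f \<Longrightarrow> f (t + 2 * pi) = f t"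
  by (auto simp: smooth_circle_map_def)

lemma smooth_circle_map_shift_int: "smooth_circle_map f \<Longrightarrow> f (t + 2 * pi * real_of_int k) = f t"
  using periodic_shift_int[of f t k] by (simp add: smooth_circle_map_def)

lemma smooth_circle_map_has_velocity:
  "smooth_circle_map f \<Longrightarrow> (f has_vector_derivative velocity f t) (at t within A)"
  using smooth_on_has_vector_derivative[OF smooth_circle_map_smooth] has_vector_derivative_at_within
  by blast

lemma smooth_circle_map_velocity:
  assumes "smooth_circle_map f" shows "smooth_circle_map (velocity f)"
proof -
  have "velocity f (t + 2 * pi) = velocity f t" for t
  proof -
    have "((\<lambda>t. f (t + 2 * pi)) has_vector_derivative velocity f (t + 2 * pi)) (at t)"
    proof -
      have "((\<lambda>t. t + 2 * pi) has_vector_derivative 1) (at t)"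
        by (auto intro!: derivative_eq_intros)
      from vector_diff_chain_at[OF this smooth_circle_map_has_velocity[OF assms]]
      show ?thesis by (simp add: comp_def)
    qed
    then have "(f has_vector_derivative velocity f (t + 2 * pi)) (at t)"
      using smooth_circle_map_periodic[OF assms] by simp
    then show ?thesis by (simp add: vector_derivative_at)
  qed
  then show ?thesis
    using assms smooth_on_vector_derivative by (auto simp: smooth_circle_map_def)
qed

lemma smooth_circle_map_add:
  assumes "smooth_circle_map f" "smooth_circle_map g"
  shows "smooth_circle_map (\<lambda>t. f t + g t)" "velocity (\<lambda>t. f t + g t) t = velocity f t + velocity g t"
  using assms
  by (auto simp: smooth_circle_map_def intro!: smooth_on_add vector_derivative_at
      has_vector_derivative_add smooth_on_has_vector_derivative[of _ UNIV])

lemma smooth_circle_map_diff: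
  assumes "smooth_circle_map f" "smooth_circle_map g"
  shows "smooth_circle_map (\<lambda>t. f t - g t)" "velocity (\<lambda>t. f t - g t) t = velocity f t - velocity g t"
  using assms
  by (auto simp: smooth_circle_map_def intro!: smooth_on_diff vector_derivative_at
      has_vector_derivative_diff smooth_on_has_vector_derivative[of _ UNIV])

lemma knot_smooth_circle_map: "parametrises_a_knot f \<Longrightarrow> smooth_circle_map f"
  by (simp add: parametrises_a_knot_def)

lemma knot_eq_imp:
  assumes f: "parametrises_a_knot f" and eq: "f s = f t"
  shows "\<exists>k::int. s = t + 2 * pi * real_of_int k"
proof -
  obtain s' and k :: int where s: "s' \<in> {0..<2 * pi}" "s = s' + 2 * pi * real_of_int k"
    by (rule circle_representative)
  obtain t' and l :: int where t: "t' \<in> {0..<2 * pi}" "t = t' + 2 * pi * real_of_int l"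
    by (rule circle_representative)
  have "f s' = f t'"
    using eq s t smooth_circle_map_shift_int[OF knot_smooth_circle_map[OF f]] by simp
  then have "s' = t'"
    using s t f by (auto simp: parametrises_a_knot_def inj_on_def)
  then show ?thesis
    using s t by (intro exI[of _ "k - l"]) (simp add: algebra_simps)
qed

lemma knot_range: "smooth_circle_map f \<Longrightarrow> range f = f ` {0..2 * pi}"
proof (intro equalityI subsetI)
  fix x assume f: "smooth_circle_map f" and "x \<in> range f"
  then obtain t where "x = f t" by blast
  moreover obtain s and k :: int where s: "s \<in> {0..<2 * pi}" "t = s + 2 * pi * real_of_int k"
    by (rule circle_representative)
  ultimately have "x = f s" "s \<in> {0..2 * pi}"
    using smooth_circle_map_shift_int[OF f] by auto
  then show "x \<in> f ` {0..2 * pi}" by blast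
qed auto

lemma compact_range_circle_map: "smooth_circle_map f \<Longrightarrow> compact (range f)"
  unfolding knot_range
  by (intro compact_continuous_image continuous_on_subset[OF smooth_on_imp_continuous_on[OF smooth_circle_map_smooth]]) auto

text \<open>An embedding of the circle is bi-Lipschitz: nearby points are separated because the velocity
  is bounded away from zero and uniformly continuous, distant ones by compactness.\<close>

lemma knot_separation:
  assumes f: "parametrises_a_knot f"
  obtains c where "c > 0" "\<And>t h. \<bar>h\<bar> \<le> pi \<Longrightarrow> c * \<bar>h\<bar> \<le> norm (f (t + h) - f t)"
proof -
  have scm: "smooth_circle_map f" using f by (rule knot_smooth_circle_map)
  have contf: "continuous_on A f" and contv: "continuous_on A (velocity f)" for A
    using smooth_on_imp_continuous_on smooth_circle_map_smooth scm smooth_circle_map_velocity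
      continuous_on_subset by (metis subset_UNIV)+
  have "\<exists>t0\<in>{0..2 * pi}. \<forall>t\<in>{0..2 * pi}. norm (velocity f t0) \<le> norm (velocity f t)"
    by (intro continuous_attains_inf continuous_intros contv) auto
  then obtain t0 where t0: "\<And>t. t \<in> {0..2 * pi} \<Longrightarrow> norm (velocity f t0) \<le> norm (velocity f t)" by blast
  define m where "m = norm (velocity f t0)"
  have m: "m > 0" using f by (auto simp: m_def parametrises_a_knot_def)
  have "uniformly_continuous_on {- pi..3 * pi} (velocity f)"
    by (intro compact_uniformly_continuous contv) auto
  then obtain d where d: "d > 0"
    "\<And>s t. s \<in> {- pi..3 * pi} \<Longrightarrow> t \<in> {- pi..3 * pi} \<Longrightarrow> dist s t < d \<Longrightarrow> dist (velocity f s) (velocity f t) < m / 2"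
    unfolding uniformly_continuous_on_def using m half_gt_zero by metis
  have near: "m / 2 * \<bar>h\<bar> \<le> norm (f (t + h) - f t)" if t: "t \<in> {0..2 * pi}" and h: "\<bar>h\<bar> < d" "\<bar>h\<bar> \<le> pi" for t h
  proof -
    have "norm (f (t + h) - f t - (t + h - t) *\<^sub>R velocity f t) \<le> norm (t + h - t) * (m / 2)"
    proof (rule vector_differentiable_bound_linearization[where S = "closed_segment t (t + h)"])
      show "(f has_vector_derivative velocity f x) (at x within closed_segment t (t + h))" for x
        by (rule smooth_circle_map_has_velocity[OF scm])
      fix x assume "x \<in> closed_segment t (t + h)"
      then have "\<bar>x - t\<bar> \<le> \<bar>h\<bar>"
        by (auto simp: closed_segment_eq_real_ivl split: if_splits)
      then have "x \<in> {- pi..3 * pi}" "t \<in> {- pi..3 * pi}" "dist x t < d"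
        using h t by (auto simp: dist_real_def)
      then show "norm (velocity f x - velocity f t) \<le> m / 2"
        using d(2)[of x t] by (simp add: dist_norm)
    qed auto
    moreover have "m * \<bar>h\<bar> \<le> norm (h *\<^sub>R velocity f t)"
      using mult_right_mono[OF t0[OF t], of "\<bar>h\<bar>"] by (simp add: m_def mult.commute)
    moreover have "norm (h *\<^sub>R velocity f t)
        \<le> norm (f (t + h) - f t) + norm (f (t + h) - f t - h *\<^sub>R velocity f t)"
      using norm_triangle_ineq4[of "f (t + h) - f t" "f (t + h) - f t - h *\<^sub>R velocity f t"] by simp
    ultimately show ?thesis by (simp add: algebra_simps)
  qed
  define C where "C = {0..2 * pi} \<times> ({- pi..pi} - {- d<..<d})"
  have "compact C" unfolding C_def by (intro compact_Times compact_diff) auto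
  have far: "\<exists>m'>0. \<forall>p\<in>C. m' \<le> norm (f (fst p + snd p) - f (fst p))"
  proof (cases "C = {}")
    case False
    have "\<exists>p0\<in>C. \<forall>p\<in>C. norm (f (fst p0 + snd p0) - f (fst p0)) \<le> norm (f (fst p + snd p) - f (fst p))"
      by (intro continuous_attains_inf continuous_intros continuous_on_compose2[OF contf[of UNIV]] \<open>compact C\<close> False) auto
    then obtain p0 where p0: "p0 \<in> C" "\<And>p. p \<in> C \<Longrightarrow> norm (f (fst p0 + snd p0) - f (fst p0)) \<le> norm (f (fst p + snd p) - f (fst p))"
      by blast
    have "f (fst p0 + snd p0) \<noteq> f (fst p0)"
    proof
      assume "f (fst p0 + snd p0) = f (fst p0)"
      then obtain k :: int where k: "snd p0 = 2 * pi * real_of_int k" using knot_eq_imp[OF f] by (metis add_left_cancel add.assoc)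
      have h: "\<bar>snd p0\<bar> \<le> pi" "snd p0 \<noteq> 0" using p0(1) d(1) by (auto simp: C_def)
      then have "\<bar>real_of_int k\<bar> \<ge> 1" using k by (cases "k = 0") auto
      then have "2 * pi * 1 \<le> \<bar>snd p0\<bar>" unfolding k abs_mult by (intro mult_mono) auto
      then show False using h pi_gt_zero by linarith
    qed
    then show ?thesis using p0 by (intro exI[of _ "norm (f (fst p0 + snd p0) - f (fst p0))"]) auto
  qed (auto intro: exI[of _ 1])
  then obtain m' where m': "m' > 0" "\<And>p. p \<in> C \<Longrightarrow> m' \<le> norm (f (fst p + snd p) - f (fst p))" by blast
  define c where "c = min (m / 2) (m' / pi)"
  have main: "c * \<bar>h\<bar> \<le> norm (f (t + h) - f t)" if t: "t \<in> {0..2 * pi}" and h: "\<bar>h\<bar> \<le> pi" for t h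
  proof (cases "\<bar>h\<bar> < d")
    case True
    have "c * \<bar>h\<bar> \<le> m / 2 * \<bar>h\<bar>" unfolding c_def by (intro mult_right_mono min.cobounded1) auto
    then show ?thesis using near[OF t True h] by linarith
  next
    case False
    then have "(t, h) \<in> C" using t h d(1) by (auto simp: C_def)
    have "c * \<bar>h\<bar> \<le> m' / pi * pi" using h m m' unfolding c_def by (intro mult_mono min.cobounded2) auto
    then show ?thesis using m'(2)[OF \<open>(t, h) \<in> C\<close>] by simp
  qed
  have "c > 0" using m m' by (auto simp: c_def)
  moreover have "c * \<bar>h\<bar> \<le> norm (f (t + h) - f t)" if h: "\<bar>h\<bar> \<le> pi" for t h
  proof -
    obtain s and k :: int where s: "s \<in> {0..<2 * pi}" "t = s + 2 * pi * real_of_int k"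
      by (rule circle_representative)
    have "f t = f s" "f (t + h) = f (s + h)"
      using smooth_circle_map_shift_int[OF scm, of s k] smooth_circle_map_shift_int[OF scm, of "s + h" k] s(2)
      by (auto simp: algebra_simps)
    then show ?thesis using main[of s h] s(1) h by simp
  qed
  ultimately show thesis by (rule that)
qed

text \<open>Closeness of the velocities suffices: the difference of the two loops is then Lipschitz with a
  small constant, which cannot undo the bi-Lipschitz separation of the points of \<open>f\<close>.\<close>

lemma knot_C1_open:
  assumes f: "parametrises_a_knot f"
  obtains r where "r > 0"
    "\<And>g. smooth_circle_map g \<Longrightarrow> (\<And>t. norm (velocity g t - velocity f t) \<le> r) \<Longrightarrow> parametrises_a_knot g"
proof -
  have scm: "smooth_circle_map f" using f by (rule knot_smooth_circle_map)
  obtain c where c: "c > 0" "\<And>t h. \<bar>h\<bar> \<le> pi \<Longrightarrow> c * \<bar>h\<bar> \<le> norm (f (t + h) - f t)"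
    using knot_separation[OF f] by blast
  have cv: "c \<le> norm (velocity f t)" for t
  proof (rule tendsto_lowerbound)
    show "((\<lambda>h. norm ((f (t + h) - f t) /\<^sub>R h)) \<longlongrightarrow> norm (velocity f t)) (at 0)"
    proof (rule tendsto_norm)
      show "((\<lambda>h. (f (t + h) - f t) /\<^sub>R h) \<longlongrightarrow> velocity f t) (at 0)"
      proof (rule LIM_zero_cancel, rule tendsto_norm_zero_cancel)
        have "((\<lambda>h. norm (f (t + h) - f t - h *\<^sub>R velocity f t) / norm h) \<longlongrightarrow> 0) (at 0)"
          using smooth_circle_map_has_velocity[OF scm, of t UNIV]
          by (simp add: has_vector_derivative_def has_derivative_at)
        then show "((\<lambda>h. norm ((f (t + h) - f t) /\<^sub>R h - velocity f t)) \<longlongrightarrow> 0) (at 0)"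
        proof (rule Lim_transform_eventually)
          have "norm (f (t + h) - f t - h *\<^sub>R velocity f t) / norm h = norm ((f (t + h) - f t) /\<^sub>R h - velocity f t)"
            if "h \<noteq> 0" for h
          proof -
            have "(f (t + h) - f t) /\<^sub>R h - velocity f t = (f (t + h) - f t - h *\<^sub>R velocity f t) /\<^sub>R h"
              using that by (simp add: scaleR_diff_right)
            then show ?thesis by (simp add: divide_inverse_commute)
          qed
          then show "\<forall>\<^sub>F h in at 0. norm (f (t + h) - f t - h *\<^sub>R velocity f t) / norm h
              = norm ((f (t + h) - f t) /\<^sub>R h - velocity f t)"
            by (auto simp: eventually_at_filter)
        qed
      qed
    qed
    have "eventually (\<lambda>h::real. \<bar>h\<bar> < pi) (at 0)"
      unfolding eventually_at using pi_gt_zero by (intro exI[of _ pi]) (auto simp: dist_real_def)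
    then show "\<forall>\<^sub>F h in at 0. c \<le> norm ((f (t + h) - f t) /\<^sub>R h)"
      using eventually_neq_at_within[of 0 0 UNIV]
    proof eventually_elim
      case (elim h)
      then show ?case using c(2)[of h t] by (simp add: pos_le_divide_eq divide_inverse_commute[symmetric])
    qed
  qed simp
  show thesis
  proof (rule that[of "c / 2"])
    fix g assume g: "smooth_circle_map g" and close: "\<And>t. norm (velocity g t - velocity f t) \<le> c / 2"
    have sep: "c / 2 * \<bar>h\<bar> \<le> norm (g (t + h) - g t)" if h: "\<bar>h\<bar> \<le> pi" for t h
    proof -
      have "norm ((g (t + h) - f (t + h)) - (g t - f t)) \<le> c / 2 * norm (t + h - t)"
      proof (rule differentiable_bound[where S = UNIV and f' = "\<lambda>x v. v *\<^sub>R (velocity g x - velocity f x)"])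
        show "((\<lambda>t. g t - f t) has_derivative (\<lambda>v. v *\<^sub>R (velocity g x - velocity f x))) (at x within UNIV)" for x
          using has_vector_derivative_diff[OF smooth_circle_map_has_velocity[OF g] smooth_circle_map_has_velocity[OF scm]]
          by (simp add: has_vector_derivative_def)
        show "onorm (\<lambda>v. v *\<^sub>R (velocity g x - velocity f x)) \<le> c / 2" for x
          using mult_right_mono[OF close[of x] abs_ge_zero] by (intro onorm_le) (simp add: mult.commute)
      qed auto
      then have "norm ((g (t + h) - g t) - (f (t + h) - f t)) \<le> c / 2 * \<bar>h\<bar>"
        by (simp add: algebra_simps)
      then show ?thesis
        using c(2)[OF h, of t] norm_triangle_ineq2[of "f (t + h) - f t" "g (t + h) - g t"]
        by (simp add: norm_minus_commute algebra_simps)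
    qed
    have "s = t" if "s \<in> {0..<2 * pi}" "t \<in> {0..<2 * pi}" "g s = g t" for s t
    proof -
      obtain h and k :: int where h: "\<bar>h\<bar> \<le> pi" "t = s + h + 2 * pi * real_of_int k"
        by (rule circle_difference)
      have "g (s + h) = g s"
        using that(3) h smooth_circle_map_shift_int[OF g] by simp
      then have "h = 0" using sep[OF h(1), of s] c(1) by (simp add: mult_le_0_iff)
      then have "t - s = 2 * pi * real_of_int k" using h by simp
      moreover have "\<bar>t - s\<bar> < 2 * pi" using that by auto
      ultimately have "2 * pi * \<bar>real_of_int k\<bar> < 2 * pi * 1" by (simp add: abs_mult)
      then have "\<bar>real_of_int k\<bar> < 1" using mult_less_cancel_left_pos pi_gt_zero by fastforce
      then have "k = 0" by linarith
      then show ?thesis using \<open>h = 0\<close> h by simp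
    qed
    moreover have "velocity g t \<noteq> 0" for t
      using close[of t] cv[of t] c(1) by (auto simp: norm_minus_commute)
    ultimately show "parametrises_a_knot g"
      using g by (auto simp: parametrises_a_knot_def inj_on_def)
  qed (use c in auto)
qed

section \<open>Extending functions from a knot to space\<close>

text \<open>The equation \<open>p' = 1 / (q' \<circ> p)\<close> for the inverse \<open>p\<close> gains one order of smoothness at a time.\<close>

lemma smooth_local_inverse:
  fixes q :: "real \<Rightarrow> real"
  assumes q: "smooth_on q UNIV" and pos: "\<And>t. t \<in> {a<..<b} \<Longrightarrow> vector_derivative q (at t) > 0"
  obtains p where "smooth_on p (q ` {a<..<b})" "\<And>t. t \<in> {a<..<b} \<Longrightarrow> p (q t) = t"
proof -
  define I where "I = {a<..<b}"
  define q' where "q' = (\<lambda>t. vector_derivative q (at t))"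
  have dq: "(q has_real_derivative q' t) (at t)" for t
    using smooth_on_has_vector_derivative[OF q] by (simp add: q'_def has_real_derivative_iff_has_vector_derivative)
  have less: "q s < q t" if "s \<in> I" "t \<in> I" "s < t" for s t
    using that pos by (intro DERIV_pos_imp_increasing[OF \<open>s < t\<close>]) (auto simp: I_def q'_def intro!: exI dq)
  then have inj: "inj_on q I" by (metis inj_onI linorder_neqE_linordered_idom order_less_irrefl)
  define p where "p = inv_into I q"
  have pq: "p (q t) = t" if "t \<in> I" for t using that inj by (simp add: p_def)
  have qp: "q (p u) = u" "p u \<in> I" if "u \<in> q ` I" for u using that by (auto simp: p_def f_inv_into_f inv_into_into)
  have contq: "continuous_on I q" using continuous_on_subset[OF smooth_on_imp_continuous_on[OF q]] by blast
  have "open I" by (simp add: I_def)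
  have J: "open (q ` I)" using invariance_of_domain[OF contq \<open>open I\<close> inj] .
  have contp: "continuous_on (q ` I) p"
    using continuous_on_inverse_open[OF \<open>open I\<close> contq, of p] pq by simp
  have dp: "(p has_real_derivative inverse (q' (p u))) (at u)" if "u \<in> q ` I" for u
  proof (rule has_field_derivative_inverse_basic[OF dq _ _ J that])
    show "q' (p u) \<noteq> 0" using pos qp(2)[OF that] unfolding q'_def I_def by fastforce
    show "continuous (at u) p" using contp J that continuous_on_eq_continuous_at by blast
  qed (rule qp(1))
  have q'_nonzero: "q' t \<noteq> 0" if "t \<in> I" for t
    using pos[of t] that by (simp add: I_def q'_def)
  have "Ck_on k p (q ` I)" for k
  proof (induction k)
    case (Suc k)
    show ?case
    proof (rule Ck_on_SucI[OF _ _ J])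
      show "(p has_derivative (\<lambda>v. inverse (q' (p u)) * v)) (at u)" if "u \<in> q ` I" for u
        using dp[OF that] by (simp add: has_field_derivative_def)
      have "smooth_on (\<lambda>t. 1 / q' t * v) I" for v
        using q'_nonzero \<open>open I\<close> unfolding q'_def
        by (intro smooth_intros smooth_on_subset[OF smooth_on_vector_derivative[OF q]]) auto
      then show "Ck_on k (\<lambda>u. inverse (q' (p u)) * v) (q ` I)" for v
        using qp by (intro Ck_on_compose[OF J \<open>open I\<close> _ _ Suc, of "\<lambda>t. inverse (q' t) * v"])
          (auto simp: smooth_on_def inverse_eq_divide)
    qed
  qed (simp add: contp)
  then show thesis
    using J pq that by (auto simp: I_def smooth_on_def)
qed

text \<open>Near a point \<open>g s\<close> of a knot the projection to the tangent at \<open>g s\<close> is a coordinate on the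
  knot, so that a function of the parameter becomes a function on space. A bump confines it to a
  ball that meets no other part of the knot.\<close>

lemma knot_local_extension:
  assumes g: "parametrises_a_knot g"
  shows "\<exists>\<rho>>0. \<forall>\<beta>. smooth_on \<beta> UNIV \<longrightarrow> (\<forall>t. \<beta> (t + 2 * pi) = \<beta> t) \<longrightarrow>
    (\<exists>D. smooth_on D UNIV \<and> (\<forall>x. x \<notin> cball (g s) \<rho> \<longrightarrow> D x = 0) \<and>
      (\<forall>t. D (g t) = bump (\<rho>\<^sup>2 - (g t - g s) \<bullet> (g t - g s)) * \<beta> t))"
proof -
  have scm: "smooth_circle_map g" using g by (rule knot_smooth_circle_map)
  define v where "v = velocity g s"
  define q where "q = (\<lambda>t. g t \<bullet> v)"
  have q: "smooth_on q UNIV"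
    unfolding q_def by (intro smooth_intros smooth_circle_map_smooth[OF scm]) auto
  have q': "vector_derivative q (at t) = velocity g t \<bullet> v" for t
    unfolding q_def
    by (intro vector_derivative_at bounded_linear.has_vector_derivative[OF bounded_linear_inner_left]
        smooth_circle_map_has_velocity scm)
  have "v \<noteq> 0" using g by (simp add: v_def parametrises_a_knot_def)
  then have "s \<in> {t. velocity g t \<bullet> v > 0}" by (simp add: v_def)
  moreover have "open {t. velocity g t \<bullet> v > 0}"
    by (intro open_Collect_less continuous_intros
          smooth_on_imp_continuous_on[OF smooth_circle_map_smooth[OF smooth_circle_map_velocity[OF scm]]])
  ultimately obtain d where d: "d > 0" "ball s d \<subseteq> {t. velocity g t \<bullet> v > 0}"
    using open_contains_ball by metis
  define I where "I = {s - d<..<s + d}"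
  have I: "I \<subseteq> {t. velocity g t \<bullet> v > 0}"
    using d by (auto simp: I_def ball_def dist_real_def subset_iff)
  obtain p where p: "smooth_on p (q ` I)" "\<And>t. t \<in> I \<Longrightarrow> p (q t) = t"
    using smooth_local_inverse[OF q, of "s - d" "s + d"] I unfolding I_def q' by blast
  define J where "J = q ` I"
  have J: "open J" using smooth_on_open[OF p(1)] by (simp add: J_def)
  have opn: "open {x. x \<bullet> v \<in> J}"
    using open_vimage[OF J, of "\<lambda>x. x \<bullet> v"] by (simp add: vimage_def continuous_intros)
  moreover have "g s \<in> {x. x \<bullet> v \<in> J}" using d by (auto simp: J_def q_def I_def)
  ultimately obtain \<rho>1 where \<rho>1: "\<rho>1 > 0" "cball (g s) \<rho>1 \<subseteq> {x. x \<bullet> v \<in> J}"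
    using open_contains_cball by metis
  obtain c where c: "c > 0" "\<And>t h. \<bar>h\<bar> \<le> pi \<Longrightarrow> c * \<bar>h\<bar> \<le> norm (g (t + h) - g t)"
    using knot_separation[OF g] by blast
  define \<rho> where "\<rho> = min \<rho>1 (c * d)"
  have "\<rho> > 0" using \<rho>1 c d by (simp add: \<rho>_def)
  moreover have "\<exists>D. smooth_on D UNIV \<and> (\<forall>x. x \<notin> cball (g s) \<rho> \<longrightarrow> D x = 0) \<and>
      (\<forall>t. D (g t) = bump (\<rho>\<^sup>2 - (g t - g s) \<bullet> (g t - g s)) * \<beta> t)"
    if \<beta>: "smooth_on \<beta> UNIV" "\<And>t. \<beta> (t + 2 * pi) = \<beta> t" for \<beta>
  proof -
    define B where "B = (\<lambda>x. bump (\<rho>\<^sup>2 - (x - g s) \<bullet> (x - g s)))"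
    have B0: "B x = 0" if "\<rho> \<le> dist (g s) x" for x
    proof -
      have "\<rho>\<^sup>2 \<le> (dist (g s) x)\<^sup>2" using that \<open>\<rho> > 0\<close> by (intro power_mono) auto
      then show ?thesis unfolding B_def
        by (intro bump_eq_0) (simp add: dist_norm norm_minus_commute power2_norm_eq_inner)
    qed
    define D where "D = (\<lambda>x. if x \<bullet> v \<in> J then B x * \<beta> (p (x \<bullet> v)) else 0)"
    have "\<exists>U. x \<in> U \<and> smooth_on D U" for x
    proof (cases "x \<bullet> v \<in> J")
      case True
      have "smooth_on (\<lambda>x. B x * \<beta> (p (x \<bullet> v))) {x. x \<bullet> v \<in> J}"
        unfolding B_def
        by (intro smooth_intros smooth_on_compose[OF \<beta>(1)] smooth_on_compose[OF p(1)] opn) (auto simp: J_def)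
      then have "smooth_on D {x. x \<bullet> v \<in> J}"
        by (rule smooth_on_cong) (auto simp: D_def)
      then show ?thesis using True by (intro exI[of _ "{x. x \<bullet> v \<in> J}"]) simp
    next
      case False
      have "smooth_on D (- cball (g s) \<rho>)"
        by (rule smooth_on_cong[OF smooth_on_const[of _ 0]]) (auto simp: D_def B0)
      moreover have "x \<notin> cball (g s) \<rho>" using False \<rho>1 by (auto simp: \<rho>_def)
      ultimately show ?thesis by (intro exI[of _ "- cball (g s) \<rho>"]) simp
    qed
    then have "smooth_on D UNIV" by (intro smooth_on_local) auto
    moreover have "D (g t) = B (g t) * \<beta> t" for t
    proof (cases "\<rho> \<le> dist (g s) (g t)")
      case True
      then show ?thesis by (simp add: D_def B0)
    next
      case False
      obtain h and k :: int where h: "\<bar>h\<bar> \<le> pi" "t = s + h + 2 * pi * real_of_int k"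
        by (rule circle_difference)
      have gt: "g t = g (s + h)" "\<beta> t = \<beta> (s + h)"
        using h smooth_circle_map_shift_int[OF scm] periodic_shift_int[of \<beta>, OF \<beta>(2)] by auto
      then have "c * \<bar>h\<bar> < c * d"
        using c(2)[OF h(1), of s] False by (auto simp: \<rho>_def dist_norm norm_minus_commute)
      then have "\<bar>h\<bar> < d" using c(1) by simp
      then have "s + h \<in> I" by (auto simp: I_def)
      then have "g t \<bullet> v \<in> J" "p (g t \<bullet> v) = s + h" using p(2) gt by (auto simp: J_def q_def)
      then show ?thesis by (simp add: D_def gt)
    qed
    ultimately show ?thesis
      using B0 by (intro exI[of _ D]) (auto simp: B_def D_def)
  qed
  ultimately show ?thesis by blast
qed

text \<open>Finitely many of the balls cover the knot. Dividing \<open>\<beta>\<close> by the sum of the bumps along the knot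
  before extending makes the local extensions add up to \<open>\<beta>\<close>. Their sum has compact support, which
  bounds its derivatives.\<close>

lemma knot_extension:
  assumes g: "parametrises_a_knot g" and \<beta>: "smooth_on \<beta> UNIV" "\<And>t. \<beta> (t + 2 * pi) = \<beta> t"
  obtains D M where "smooth_on D UNIV" "\<And>t. D (g t) = \<beta> t" "\<And>x. \<bar>frechet_derivative D (at x) e\<bar> \<le> (M::real)"
proof -
  have scm: "smooth_circle_map g" using g by (rule knot_smooth_circle_map)
  obtain \<rho> where \<rho>: "\<And>s. \<rho> s > 0" and ext: "\<And>s \<beta>. smooth_on \<beta> UNIV \<Longrightarrow> (\<And>t. \<beta> (t + 2 * pi) = \<beta> t) \<Longrightarrow>
    (\<exists>D. smooth_on D UNIV \<and> (\<forall>x. x \<notin> cball (g s) (\<rho> s) \<longrightarrow> D x = 0) \<and>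
      (\<forall>t. D (g t) = bump ((\<rho> s)\<^sup>2 - (g t - g s) \<bullet> (g t - g s)) * \<beta> t))"
    using knot_local_extension[OF g] by metis
  have "range g \<subseteq> (\<Union>s\<in>UNIV. ball (g s) (\<rho> s))" using \<rho> by auto
  then obtain F where F: "finite F" "range g \<subseteq> (\<Union>s\<in>F. ball (g s) (\<rho> s))"
    using compactE_image[OF compact_range_circle_map[OF scm], of UNIV "\<lambda>s. ball (g s) (\<rho> s)"] by auto
  define b where "b = (\<lambda>s t. bump ((\<rho> s)\<^sup>2 - (g t - g s) \<bullet> (g t - g s)))"
  define S where "S = (\<lambda>t. \<Sum>s\<in>F. b s t)"
  have S_pos: "S t > 0" for t
  proof -
    obtain s where s: "s \<in> F" "g t \<in> ball (g s) (\<rho> s)" using F(2) by blast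
    then have "(norm (g t - g s))\<^sup>2 < (\<rho> s)\<^sup>2"
      by (intro power_strict_mono) (auto simp: dist_norm norm_minus_commute)
    then have "b s t > 0" by (simp add: b_def bump_pos_iff power2_norm_eq_inner)
    then show ?thesis
      unfolding S_def using F(1) s(1) by (intro sum_pos2) (auto simp: b_def bump_nonneg)
  qed
  have "smooth_on (\<lambda>t. \<beta> t / S t) UNIV"
    using S_pos unfolding S_def b_def
    by (intro smooth_intros \<beta>(1) smooth_circle_map_smooth[OF scm]) (auto simp: less_le)
  moreover have "\<beta> (t + 2 * pi) / S (t + 2 * pi) = \<beta> t / S t" for t
    by (simp add: \<beta>(2) S_def b_def smooth_circle_map_periodic[OF scm])
  ultimately have "\<exists>D. \<forall>s. smooth_on (D s) UNIV \<and> (\<forall>x. x \<notin> cball (g s) (\<rho> s) \<longrightarrow> D s x = 0) \<and>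
      (\<forall>t. D s (g t) = b s t * (\<beta> t / S t))"
    unfolding b_def using ext[of "\<lambda>t. \<beta> t / S t"] by (intro choice) blast
  then obtain D where D: "\<And>s. smooth_on (D s) UNIV" "\<And>s x. x \<notin> cball (g s) (\<rho> s) \<Longrightarrow> D s x = 0"
      "\<And>s t. D s (g t) = b s t * (\<beta> t / S t)"
    by blast
  define E where "E = (\<lambda>x. \<Sum>s\<in>F. D s x)"
  have E: "smooth_on E UNIV" unfolding E_def by (intro smooth_intros D) auto
  define C where "C = (\<Union>s\<in>F. cball (g s) (\<rho> s))"
  have C: "compact C" unfolding C_def using F(1) by (intro compact_UN) auto
  have E0: "E x = 0" if "x \<notin> C" for x
    unfolding E_def using that by (intro sum.neutral) (auto simp: C_def D(2))
  have "bounded ((\<lambda>x. frechet_derivative E (at x) e) ` C)"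
    using smooth_on_imp_continuous_on[OF smooth_on_frechet_derivative[OF E]] C continuous_on_subset
    by (intro compact_imp_bounded compact_continuous_image) blast+
  then obtain M where M: "\<And>x. x \<in> C \<Longrightarrow> \<bar>frechet_derivative E (at x) e\<bar> \<le> M"
    unfolding bounded_iff by auto
  have "\<bar>frechet_derivative E (at x) e\<bar> \<le> max M 0" for x
  proof (cases "x \<in> C")
    case False
    have "open (- C)" using C by (simp add: compact_imp_closed open_Compl)
    then have "(E has_derivative (\<lambda>v. 0)) (at x)"
      using False E0 by (intro has_derivative_transform_within_open[OF has_derivative_const[of 0]]) auto
    then have "frechet_derivative E (at x) = (\<lambda>v. 0)" using frechet_derivative_at by metis
    then show ?thesis by simp
  qed (use M[of x] in \<open>simp add: le_max_iff_disj\<close>)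
  moreover have "E (g t) = \<beta> t" for t
  proof -
    have "E (g t) = (\<Sum>s\<in>F. b s t) * (\<beta> t / S t)" by (simp only: E_def D(3) sum_distrib_right)
    then have "E (g t) = S t * (\<beta> t / S t)" by (simp only: S_def)
    then show ?thesis using S_pos[of t] by simp
  qed
  ultimately show thesis using that E by blast
qed

section \<open>Stability of the knot type\<close>

text \<open>Along a straight path of embeddings with a fixed direction \<open>e\<close>, the displacement at each
  time extends to a function on space, and short further motions are directional moves. The knot
  type is thus locally constant in time.\<close>

lemma isotopic_along_direction:
  assumes knots: "\<And>\<tau>. \<tau> \<in> {0..1} \<Longrightarrow> parametrises_a_knot (\<lambda>t. g t + (\<tau> * \<beta> t) *\<^sub>R e)"
    and \<beta>: "smooth_on \<beta> UNIV" "\<And>t. \<beta> (t + 2 * pi) = \<beta> t"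
  shows "ambient_isotopic (range g) (range (\<lambda>t. g t + \<beta> t *\<^sub>R e))"
proof -
  define P where "P = (\<lambda>\<tau>. range (\<lambda>t. g t + (\<tau> * \<beta> t) *\<^sub>R e))"
  have local: "\<exists>T. openin (top_of_set {0..1}) T \<and> \<tau> \<in> T \<and> (\<forall>\<sigma>\<in>T. ambient_isotopic (P \<tau>) (P \<sigma>))"
    if \<tau>: "\<tau> \<in> {0..1}" for \<tau>
  proof -
    obtain D M where D: "smooth_on D UNIV" "\<And>t. D (g t + (\<tau> * \<beta> t) *\<^sub>R e) = \<beta> t"
        "\<And>x. \<bar>frechet_derivative D (at x) e\<bar> \<le> M"
      using knot_extension[OF knots[OF \<tau>] \<beta>] by metis
    have "M \<ge> 0" using D(3)[of 0] by linarith
    have iso: "ambient_isotopic (P \<tau>) (P \<sigma>)" if \<sigma>: "\<bar>\<sigma> - \<tau>\<bar> < 1 / (2 * (M + 1))" for \<sigma>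
    proof -
      have "ambient_isotopic (P \<tau>) ((\<lambda>x. x + ((\<sigma> - \<tau>) * D x) *\<^sub>R e) ` P \<tau>)"
      proof (rule ambient_isotopic_directional_move)
        show "smooth_on (\<lambda>x. (\<sigma> - \<tau>) * D x) UNIV" by (intro smooth_intros D) auto
        fix x
        have "((\<lambda>x. (\<sigma> - \<tau>) * D x) has_derivative (\<lambda>v. (\<sigma> - \<tau>) * frechet_derivative D (at x) v)) (at x)"
          by (intro derivative_intros smooth_on_has_derivative[OF D(1)]) auto
        then have "\<bar>frechet_derivative (\<lambda>x. (\<sigma> - \<tau>) * D x) (at x) e\<bar> = \<bar>\<sigma> - \<tau>\<bar> * \<bar>frechet_derivative D (at x) e\<bar>"
          using frechet_derivative_at by (metis abs_mult)
        also have "\<dots> \<le> 1 / (2 * (M + 1)) * (M + 1)"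
          using \<sigma> D(3)[of x] \<open>M \<ge> 0\<close> by (intro mult_mono) auto
        also have "\<dots> = 1 / 2" using \<open>M \<ge> 0\<close> by (simp add: field_simps)
        finally show "\<bar>frechet_derivative (\<lambda>x. (\<sigma> - \<tau>) * D x) (at x) e\<bar> \<le> 1 / 2" .
      qed
      moreover have "(\<lambda>x. x + ((\<sigma> - \<tau>) * D x) *\<^sub>R e) ` P \<tau> = P \<sigma>"
        unfolding P_def image_image D(2) by (simp add: algebra_simps)
      ultimately show ?thesis by simp
    qed
    show ?thesis
      using \<tau> iso \<open>M \<ge> 0\<close>
      by (intro exI[of _ "{0..1} \<inter> ball \<tau> (1 / (2 * (M + 1)))"])
         (auto simp: dist_real_def abs_minus_commute)
  qed
  have "ambient_isotopic (P 0) (P 1)"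
  proof (rule connected_equivalence_relation[where S = "{0..1::real}" and R = "\<lambda>a b. ambient_isotopic (P a) (P b)"])
    show "ambient_isotopic (P b) (P a)" if "ambient_isotopic (P a) (P b)" for a b
      using that by (rule ambient_isotopic_sym)
    show "ambient_isotopic (P a) (P c)" if "ambient_isotopic (P a) (P b)" "ambient_isotopic (P b) (P c)" for a b c
      using that by (rule ambient_isotopic_trans)
  qed (use local in auto)
  then show ?thesis by (simp add: P_def)
qed

text \<open>A small perturbation is carried out one coordinate at a time; all intermediate curves stay
  as close to \<open>f\<close> as the final one.\<close>

lemma knot_type_stable:
  assumes f: "parametrises_a_knot f"
  obtains r where "r > 0"
    "\<And>g. smooth_circle_map g \<Longrightarrow> (\<And>t. norm (velocity g t - velocity f t) \<le> r) \<Longrightarrow>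
        parametrises_a_knot g \<and> ambient_isotopic (range g) (range f)"
proof -
  have scm: "smooth_circle_map f" using f by (rule knot_smooth_circle_map)
  obtain r where r: "r > 0"
    "\<And>g. smooth_circle_map g \<Longrightarrow> (\<And>t. norm (velocity g t - velocity f t) \<le> r) \<Longrightarrow> parametrises_a_knot g"
    using knot_C1_open[OF f] by blast
  show thesis
  proof (rule that[OF r(1)])
    fix g assume g: "smooth_circle_map g" and close: "\<And>t. norm (velocity g t - velocity f t) \<le> r"
    define \<delta> where "\<delta> = (\<lambda>t. g t - f t)"
    have \<delta>: "smooth_circle_map \<delta>" and v\<delta>: "velocity \<delta> t = velocity g t - velocity f t" for t
      unfolding \<delta>_def using smooth_circle_map_diff[OF g scm] by auto
    have \<delta>i: "smooth_on (\<lambda>t. \<delta> t $ i) UNIV" for i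
      by (rule smooth_on_linear_compose[OF bounded_linear_vec_nth smooth_circle_map_smooth[OF \<delta>]])
    define w where "w = (\<lambda>(c :: 3 \<Rightarrow> real) t. f t + (\<Sum>i\<in>UNIV. (c i * \<delta> t $ i) *\<^sub>R axis i (1::real)))"
    have knot: "parametrises_a_knot (w c)" if c: "\<And>i. c i \<in> {0..1}" for c
    proof (rule r(2))
      show "smooth_circle_map (w c)"
        unfolding smooth_circle_map_def w_def
        by (intro conjI allI smooth_intros smooth_circle_map_smooth[OF scm] \<delta>i)
           (auto simp: smooth_circle_map_periodic[OF scm] smooth_circle_map_periodic[OF \<delta>])
      fix t
      have "(w c has_vector_derivative velocity f t + (\<Sum>i\<in>UNIV. (c i * velocity \<delta> t $ i) *\<^sub>R axis i 1)) (at t)"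
        unfolding w_def
        by (auto intro!: derivative_eq_intros smooth_circle_map_has_velocity[OF scm]
            bounded_linear.has_vector_derivative[OF bounded_linear_vec_nth]
            smooth_circle_map_has_velocity[OF \<delta>] has_vector_derivative_scaleR
            simp: has_real_derivative_iff_has_vector_derivative mult.commute)
      then have "velocity (w c) t - velocity f t = (\<Sum>i\<in>UNIV. (c i * velocity \<delta> t $ i) *\<^sub>R axis i 1)"
        by (simp add: vector_derivative_at)
      also have "norm \<dots> \<le> norm (velocity \<delta> t)"
      proof (rule norm_le_componentwise_cart)
        fix j
        have "(\<Sum>i\<in>UNIV. (c i * velocity \<delta> t $ i) *\<^sub>R axis i (1::real)) $ j = c j * velocity \<delta> t $ j"
          by (simp add: axis_def if_distrib cong: if_cong)
        then show "norm ((\<Sum>i\<in>UNIV. (c i * velocity \<delta> t $ i) *\<^sub>R axis i (1::real)) $ j) \<le> norm (velocity \<delta> t $ j)"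
          using c[of j] by (simp add: abs_mult mult_left_le_one_le)
      qed
      finally show "norm (velocity (w c) t - velocity f t) \<le> r" using close[of t] v\<delta> by simp
    qed
    have iso: "ambient_isotopic (range f) (range (w (indicator A)))" if "finite A" for A :: "3 set"
      using that
    proof (induction A)
      case empty
      then show ?case by (simp add: w_def ambient_isotopic_refl)
    next
      case (insert j A)
      have eq: "w (\<lambda>i. indicator A i + \<tau> * indicator {j} i) t = w (indicator A) t + (\<tau> * \<delta> t $ j) *\<^sub>R axis j 1" for \<tau> t
      proof -
        have "(\<Sum>i\<in>UNIV. (\<tau> * indicator {j} i * \<delta> t $ i) *\<^sub>R axis i (1::real)) = (\<tau> * \<delta> t $ j) *\<^sub>R axis j 1"
        proof -
          have "(\<tau> * indicator {j} i * \<delta> t $ i) *\<^sub>R axis i (1::real) =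
              (if i = j then (\<tau> * \<delta> t $ j) *\<^sub>R axis j 1 else 0)" for i
            by (simp add: indicator_def)
          then show ?thesis by simp
        qed
        then show ?thesis by (simp add: w_def algebra_simps sum.distrib)
      qed
      have "ambient_isotopic (range (w (indicator A))) (range (\<lambda>t. w (indicator A) t + \<delta> t $ j *\<^sub>R axis j 1))"
      proof (rule isotopic_along_direction)
        fix \<tau> :: real assume "\<tau> \<in> {0..1}"
        then have "parametrises_a_knot (w (\<lambda>i. indicator A i + \<tau> * indicator {j} i))"
          using insert by (intro knot) (auto simp: indicator_def)
        then show "parametrises_a_knot (\<lambda>t. w (indicator A) t + (\<tau> * \<delta> t $ j) *\<^sub>R axis j 1)"
          unfolding eq[symmetric] .
      qed (auto simp: \<delta>i smooth_circle_map_periodic[OF \<delta>])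
      moreover have "(\<lambda>t. w (indicator A) t + \<delta> t $ j *\<^sub>R axis j 1) = w (indicator (insert j A))"
      proof -
        have "(\<lambda>i. indicator A i + 1 * indicator {j} i) = (indicator (insert j A) :: 3 \<Rightarrow> real)"
          using insert by (auto simp: indicator_def fun_eq_iff)
        then show ?thesis using eq[of 1] by (auto simp: fun_eq_iff)
      qed
      ultimately show ?case using ambient_isotopic_trans[OF insert.IH] by (simp only:)
    qed
    have "w (indicator UNIV) = g"
      using basis_expansion[of "\<delta> t" for t] by (auto simp: w_def fun_eq_iff \<delta>_def vec_eq_iff axis_def if_distrib cong: if_cong)
    then have "ambient_isotopic (range f) (range g)" using iso[of UNIV] by simp
    then show "parametrises_a_knot g \<and> ambient_isotopic (range g) (range f)"
      using r(2)[OF g close] ambient_isotopic_sym by blast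
  qed
qed

section \<open>Every smooth loop is close to an embedded one\<close>

lemma smooth_on_imp_differentiable_on: "smooth_on f S \<Longrightarrow> f differentiable_on S"
  using smooth_on_has_derivative has_derivative_at_withinI
  unfolding differentiable_on_def differentiable_def by blast

text \<open>For two parameters \<open>s, t\<close> with \<open>\<phi> s \<noteq> \<phi> t\<close>, a single vector \<open>a\<close> makes \<open>u + \<phi> a\<close> collide, so
  the colliding vectors form the image of a surface in space. Similarly for vanishing velocities,
  which form the image of a curve.\<close>

lemma negligible_collisions:
  fixes u :: "real \<Rightarrow> real^3" and \<phi> :: "real \<Rightarrow> real"
  assumes u: "smooth_on u UNIV" and \<phi>: "smooth_on \<phi> UNIV"
  shows "negligible {a. \<exists>s t. \<phi> s \<noteq> \<phi> t \<and> u s + \<phi> s *\<^sub>R a = u t + \<phi> t *\<^sub>R a}"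
proof -
  define S where "S = {p. \<phi> (fst p) - \<phi> (snd p) \<noteq> 0}"
  define F where "F = (\<lambda>p. (1 / (\<phi> (fst p) - \<phi> (snd p))) *\<^sub>R (u (snd p) - u (fst p)))"
  have "open S" unfolding S_def
    by (intro open_Collect_neq continuous_intros
        continuous_on_compose2[OF smooth_on_imp_continuous_on[OF \<phi>]]) auto
  then have "smooth_on F S"
    unfolding F_def
    by (intro smooth_intros smooth_on_compose[OF u] smooth_on_compose[OF \<phi>]) (auto simp: S_def)
  then have "negligible (F ` S)"
    by (intro negligible_differentiable_image_lowdim smooth_on_imp_differentiable_on) auto
  moreover have "{a. \<exists>s t. \<phi> s \<noteq> \<phi> t \<and> u s + \<phi> s *\<^sub>R a = u t + \<phi> t *\<^sub>R a} \<subseteq> F ` S"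
  proof clarify
    fix a s t assume *: "\<phi> s \<noteq> \<phi> t" "u s + \<phi> s *\<^sub>R a = u t + \<phi> t *\<^sub>R a"
    then have "u t - u s = (\<phi> s - \<phi> t) *\<^sub>R a" by (simp add: algebra_simps)
    with * have "a = F (s, t)" by (simp add: F_def)
    with * show "a \<in> F ` S" by (auto simp: S_def)
  qed
  ultimately show ?thesis by (rule negligible_subset)
qed

lemma negligible_stationary:
  fixes u :: "real \<Rightarrow> real^3" and \<phi> :: "real \<Rightarrow> real"
  assumes u: "smooth_on u UNIV" and \<phi>: "smooth_on \<phi> UNIV"
  shows "negligible {a. \<exists>t. \<phi> t \<noteq> 0 \<and> u t + \<phi> t *\<^sub>R a = 0}"
proof -
  define S where "S = {t. \<phi> t \<noteq> 0}"
  define F where "F = (\<lambda>t. (1 / \<phi> t) *\<^sub>R (- u t))"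
  have "open S" unfolding S_def
    by (intro open_Collect_neq continuous_intros smooth_on_imp_continuous_on[OF \<phi>])
  then have "smooth_on F S"
    unfolding F_def
    by (intro smooth_intros smooth_on_subset[OF u] smooth_on_subset[OF \<phi>]) (auto simp: S_def)
  then have "negligible (F ` S)"
    by (intro negligible_differentiable_image_lowdim smooth_on_imp_differentiable_on) auto
  moreover have "{a. \<exists>t. \<phi> t \<noteq> 0 \<and> u t + \<phi> t *\<^sub>R a = 0} \<subseteq> F ` S"
  proof clarify
    fix a t assume *: "\<phi> t \<noteq> 0" "u t + \<phi> t *\<^sub>R a = 0"
    then have "- u t = \<phi> t *\<^sub>R a" by (metis minus_unique)
    then have "a = F t" unfolding F_def using *(1) by (simp only: scaleR_scaleR) simp
    with * show "a \<in> F ` S" by (auto simp: S_def)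
  qed
  ultimately show ?thesis by (rule negligible_subset)
qed

lemma ex_small_not_negligible:
  fixes N :: "(real^3) set"
  assumes "negligible N" "e > 0"
  obtains a where "norm a < e" "a \<notin> N"
proof -
  have "\<not> negligible (ball 0 e :: (real^3) set)"
    using assms(2) by (intro open_not_negligible) auto
  then have "\<not> ball 0 e \<subseteq> N" using assms(1) negligible_subset by blast
  then obtain a where "a \<in> ball 0 e" "a \<notin> N" by blast
  then show thesis using that by (simp add: dist_norm)
qed

definition trig :: "real^3 \<Rightarrow> real^3 \<Rightarrow> real \<Rightarrow> real^3" where
  "trig a b t = cos t *\<^sub>R a + sin t *\<^sub>R b"

lemma smooth_circle_map_trig: "smooth_circle_map (trig a b)"
  unfolding smooth_circle_map_def trig_def by (intro conjI smooth_intros) auto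

lemma velocity_trig: "velocity (trig a b) = trig b (- a)"
proof
  fix t show "velocity (trig a b) t = trig b (- a) t"
    unfolding trig_def
    by (rule vector_derivative_at) (auto intro!: derivative_eq_intros simp: has_real_derivative_iff_has_vector_derivative[symmetric])
qed

lemma norm_trig_le: "norm (trig a b t) \<le> norm a + norm b"
proof -
  have "norm (trig a b t) \<le> \<bar>cos t\<bar> * norm a + \<bar>sin t\<bar> * norm b"
    unfolding trig_def using norm_triangle_ineq by (metis norm_scaleR)
  also have "\<dots> \<le> 1 * norm a + 1 * norm b"
    by (intro add_mono mult_right_mono) auto
  finally show ?thesis by simp
qed

text \<open>Two parameters with the same cosine and the same sine are the same point of the circle.
  Hence \<open>a\<close> first takes care of the pairs with different cosines, and then \<open>b\<close> of those with
  different sines, without affecting the pairs with equal sines.\<close>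

lemma knot_generic_perturbation:
  assumes h: "smooth_circle_map h" and "e > 0"
  obtains a b where "norm a < e" "norm b < e" "parametrises_a_knot (\<lambda>t. h t + trig a b t)"
proof -
  have sm: "smooth_on h UNIV" using h by (rule smooth_circle_map_smooth)
  have sc: "smooth_on cos (UNIV :: real set)" "smooth_on sin (UNIV :: real set)"
    "smooth_on (\<lambda>t. - sin t) (UNIV :: real set)"
    by (intro smooth_intros open_UNIV)+
  obtain a where a: "norm a < e" "a \<notin> {a. \<exists>s t. cos s \<noteq> cos t \<and> h s + cos s *\<^sub>R a = h t + cos t *\<^sub>R a}
      \<union> {a. \<exists>t. - sin t \<noteq> 0 \<and> velocity h t + (- sin t) *\<^sub>R a = 0}"
    by (rule ex_small_not_negligible[OF negligible_Un[OF negligible_collisions[OF sm sc(1)]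
      negligible_stationary[OF smooth_on_vector_derivative[OF sm] sc(3)]] \<open>e > 0\<close>])
  define k where "k = (\<lambda>t. h t + trig a 0 t)"
  have k: "smooth_circle_map k" "\<And>t. velocity k t = velocity h t + (- sin t) *\<^sub>R a"
    unfolding k_def using smooth_circle_map_add[OF h smooth_circle_map_trig[of a 0]]
    by (simp_all add: fun_cong[OF velocity_trig]) (simp_all add: trig_def)
  have smk: "smooth_on k UNIV" using k(1) by (rule smooth_circle_map_smooth)
  obtain b where b: "norm b < e" "b \<notin> {a. \<exists>s t. sin s \<noteq> sin t \<and> k s + sin s *\<^sub>R a = k t + sin t *\<^sub>R a}
      \<union> {a. \<exists>t. cos t \<noteq> 0 \<and> velocity k t + cos t *\<^sub>R a = 0}"
    by (rule ex_small_not_negligible[OF negligible_Un[OF negligible_collisions[OF smk sc(2)]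
      negligible_stationary[OF smooth_on_vector_derivative[OF smk] sc(1)]] \<open>e > 0\<close>])
  define g where "g = (\<lambda>t. h t + trig a b t)"
  have g_eq: "g = (\<lambda>t. k t + trig 0 b t)" by (auto simp: g_def k_def trig_def)
  have g: "smooth_circle_map g" "\<And>t. velocity g t = velocity k t + cos t *\<^sub>R b"
    unfolding g_eq using smooth_circle_map_add[OF k(1) smooth_circle_map_trig[of 0 b]]
    by (simp_all add: fun_cong[OF velocity_trig]) (simp_all add: trig_def)
  have "velocity g t \<noteq> 0" for t
  proof (cases "cos t = 0")
    case True
    then have "sin t \<noteq> 0" using sin_cos_squared_add[of t] by auto
    then show ?thesis using True a(2) by (auto simp: g k)
  next
    case False
    then show ?thesis using b(2) by (auto simp: g(2))
  qed
  moreover have "s = t" if st: "s \<in> {0..<2 * pi}" "t \<in> {0..<2 * pi}" "g s = g t" for s t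
  proof -
    have "sin s = sin t" using b(2) st(3) by (auto simp: g_eq trig_def)
    moreover from this have "k s = k t" using st(3) by (simp add: g_eq trig_def)
    then have "cos s = cos t" using a(2) by (auto simp: k_def trig_def)
    ultimately obtain n :: int where n: "s = t + 2 * pi * real_of_int n"
      using sin_cos_eq_iff[of s t] by auto
    then have "2 * pi * \<bar>real_of_int n\<bar> = \<bar>s - t\<bar>" by (simp add: abs_mult)
    also have "\<dots> < 2 * pi * 1" using st by auto
    finally have "\<bar>real_of_int n\<bar> < 1" using mult_less_cancel_left_pos[of "2 * pi"] by simp
    then have "n = 0" by linarith
    then show ?thesis using n by simp
  qed
  ultimately have "parametrises_a_knot g"
    using g(1) by (auto simp: parametrises_a_knot_def inj_on_def)
  then show thesis using that a(1) b(1) unfolding g_def by blast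
qed

section \<open>Higher derivatives and periodic antiderivatives\<close>

lemma nth_derivative_0 [simp]: "nth_derivative 0 f = f"
  and nth_derivative_Suc: "nth_derivative (Suc n) f = velocity (nth_derivative n f)"
  by (simp_all add: nth_derivative_def)

lemma nth_derivative_Suc': "nth_derivative (Suc n) f = nth_derivative n (velocity f)"
  by (simp add: nth_derivative_def funpow_Suc_right del: funpow.simps)

lemma smooth_circle_map_nth_derivative: "smooth_circle_map f \<Longrightarrow> smooth_circle_map (nth_derivative n f)"
  by (induction n) (auto simp: nth_derivative_Suc smooth_circle_map_velocity)

lemma nth_derivative_plus:
  assumes "smooth_circle_map f" "smooth_circle_map g"
  shows "nth_derivative n (\<lambda>t. f t + g t) = (\<lambda>t. nth_derivative n f t + nth_derivative n g t)"
proof (induction n)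
  case (Suc n)
  show ?case
    unfolding nth_derivative_Suc Suc
    using smooth_circle_map_add(2) smooth_circle_map_nth_derivative assms by blast
qed simp

lemma norm_nth_derivative_trig_le: "norm (nth_derivative n (trig a b) t) \<le> norm a + norm b"
proof (induction n arbitrary: a b)
  case 0
  then show ?case by (simp add: norm_trig_le)
next
  case (Suc n)
  show ?case using Suc[of b "- a"] by (simp add: nth_derivative_Suc' velocity_trig add.commute)
qed

lemma trig_eq_nth_derivative:
  obtains a' b' where "nth_derivative n (trig a' b') = trig a b" "norm a' + norm b' = norm a + norm b"
proof -
  have "\<exists>a' b'. nth_derivative n (trig a' b') = trig a b \<and> norm a' + norm b' = norm a + norm b"
  proof (induction n arbitrary: a b)
    case (Suc n)
    obtain a' b' where *: "nth_derivative n (trig a' b') = trig (- b) a" "norm a' + norm b' = norm (- b) + norm a"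
      using Suc by metis
    then have "nth_derivative (Suc n) (trig a' b') = trig a b"
      by (simp add: nth_derivative_Suc velocity_trig)
    then show ?case using *(2) by (intro exI[of _ a'] exI[of _ b']) auto
  qed auto
  then show thesis using that by blast
qed

lemma antiderivative_real_line:
  fixes u :: "real \<Rightarrow> 'a::euclidean_space"
  assumes "continuous_on UNIV u"
  obtains V where "\<And>t. (V has_vector_derivative u t) (at t)"
    "\<And>t. t \<ge> 0 \<Longrightarrow> V t = integral {0..t} u"
proof -
  have int: "u integrable_on {a..b}" for a b
    using assms continuous_on_subset by (intro integrable_continuous_interval) blast
  define V where "V = (\<lambda>t. integral {0..t} u - integral {t..0} u)"
  have V: "V t = integral {- c..t} u - integral {- c..0} u" if "c \<ge> 0" "t \<ge> - c" for c t
  proof (cases "t \<ge> 0")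
    case True
    have "integral {t..0} u = 0" using True by (cases "t = 0") auto
    then show ?thesis
      using Henstock_Kurzweil_Integration.integral_combine[of "- c" 0 t u] True that int
      by (simp add: V_def eq_diff_eq add.commute)
  next
    case False
    then show ?thesis
      using Henstock_Kurzweil_Integration.integral_combine[of "- c" t 0 u] that int
      by (simp add: V_def algebra_simps)
  qed
  show thesis
  proof (rule that[of V])
    fix t :: real
    define c where "c = \<bar>t\<bar> + 1"
    have "((\<lambda>t. integral {- c..t} u) has_vector_derivative u t) (at t within {- c..c})"
      using assms continuous_on_subset by (intro integral_has_vector_derivative) (auto simp: c_def)
    then have "((\<lambda>t. integral {- c..t} u - integral {- c..0} u) has_vector_derivative u t) (at t)"
      by (auto intro!: derivative_eq_intros simp: c_def at_within_Icc_at)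
    then show "(V has_vector_derivative u t) (at t)"
    proof (rule has_vector_derivative_transform_within_open[where S = "{- c<..<c}"])
      show "integral {- c..s} u - integral {- c..0} u = V s" if "s \<in> {- c<..<c}" for s
        using V[of c s] that by simp
    qed (auto simp: c_def)
    show "V t = integral {0..t} u" if "t \<ge> 0"
      using V[of 0 t] that by simp
  qed
qed

text \<open>The mean is normalised to zero so that the construction can be iterated.\<close>

lemma periodic_antiderivative:
  assumes u: "smooth_circle_map u" and mean: "integral {0..2 * pi} u = 0"
    and bound: "\<And>t. t \<in> {0..2 * pi} \<Longrightarrow> norm (integral {0..t} u) \<le> M"
  obtains U where "smooth_circle_map U" "velocity U = u" "integral {0..2 * pi} U = 0" "\<And>t. norm (U t) \<le> 2 * M"
proof -
  have contu: "continuous_on UNIV u"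
    using smooth_on_imp_continuous_on[OF smooth_circle_map_smooth[OF u]] .
  obtain V where V: "\<And>t. (V has_vector_derivative u t) (at t)" "\<And>t. t \<ge> 0 \<Longrightarrow> V t = integral {0..t} u"
    using antiderivative_real_line[OF contu] by blast
  have per: "V (t + 2 * pi) = V t" for t
  proof -
    have "((\<lambda>t. V (t + 2 * pi) - V t) has_vector_derivative 0) (at t)" for t
    proof -
      have "((\<lambda>t. t + 2 * pi) has_vector_derivative 1) (at t)"
        by (auto intro!: derivative_eq_intros)
      from vector_diff_chain_at[OF this V(1)]
      have "((\<lambda>t. V (t + 2 * pi)) has_vector_derivative u t) (at t)"
        by (simp add: comp_def smooth_circle_map_periodic[OF u])
      from has_vector_derivative_diff[OF this V(1)] show ?thesis by simp
    qed
    then have "((\<lambda>t. V (t + 2 * pi) - V t) has_derivative (\<lambda>h. 0)) (at t within UNIV)" for t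
      by (simp add: has_vector_derivative_def)
    then obtain c where "\<And>t. V (t + 2 * pi) - V t = c"
      using has_derivative_zero_constant[of UNIV "\<lambda>t. V (t + 2 * pi) - V t"] by auto
    moreover have "V (0 + 2 * pi) - V 0 = 0" using mean by (simp add: V(2))
    ultimately show ?thesis by (metis eq_iff_diff_eq_0)
  qed
  have smV: "smooth_on V UNIV"
    using smooth_on_from_vector_derivative[OF V(1)] smooth_circle_map_smooth[OF u] by blast
  have VM: "norm (V t) \<le> M" for t
  proof -
    obtain s and k :: int where s: "s \<in> {0..<2 * pi}" "t = s + 2 * pi * real_of_int k"
      by (rule circle_representative)
    then have "V t = V s" using periodic_shift_int[of V, OF per] by simp
    then show ?thesis using s(1) bound[of s] V(2)[of s] by simp
  qed
  define c where "c = (1 / (2 * pi)) *\<^sub>R integral {0..2 * pi} V"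
  have intV: "V integrable_on {0..2 * pi}"
    using smooth_on_imp_continuous_on[OF smV] continuous_on_subset
    by (intro integrable_continuous_interval) blast
  have "norm (integral {0..2 * pi} V) \<le> M * (2 * pi - 0)"
    using VM by (intro integral_bound continuous_on_subset[OF smooth_on_imp_continuous_on[OF smV]]) auto
  then have cM: "norm c \<le> M" by (simp add: c_def field_simps)
  show thesis
  proof (rule that[of "\<lambda>t. V t - c"])
    show "smooth_circle_map (\<lambda>t. V t - c)"
      unfolding smooth_circle_map_def using per smV by (auto intro!: smooth_intros)
    show "velocity (\<lambda>t. V t - c) = u"
    proof
      show "velocity (\<lambda>t. V t - c) t = u t" for t
        using has_vector_derivative_diff[OF V(1) has_vector_derivative_const[of c]]
        by (intro vector_derivative_at) simp
    qed
    show "integral {0..2 * pi} (\<lambda>t. V t - c) = 0"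
    proof -
      have "integral {0..2 * pi} (\<lambda>t. V t - c) = integral {0..2 * pi} V - integral {0..2 * pi} (\<lambda>t. c)"
        by (rule Henstock_Kurzweil_Integration.integral_diff[OF intV]) auto
      then show ?thesis by (simp add: c_def)
    qed
    show "norm (V t - c) \<le> 2 * M" for t
      using norm_triangle_ineq4[of "V t" c] VM[of t] cM by linarith
  qed
qed

text \<open>Only the first integral of \<open>u\<close> enters the bound: a large \<open>u\<close> with small integrals is the
  derivative of order \<open>n + 1\<close> of a loop whose derivatives up to order \<open>n\<close> are small.\<close>

lemma iterated_periodic_antiderivative:
  assumes u: "smooth_circle_map u" and mean: "integral {0..2 * pi} u = 0"
    and bound: "\<And>t. t \<in> {0..2 * pi} \<Longrightarrow> norm (integral {0..t} u) \<le> M"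
  shows "\<exists>U. smooth_circle_map U \<and> nth_derivative (Suc n) U = u \<and> integral {0..2 * pi} U = 0 \<and>
    (\<forall>j\<le>n. \<forall>t. norm (nth_derivative j U t) \<le> 2 * (4 * pi) ^ n * M)"
proof (induction n)
  case 0
  obtain U where "smooth_circle_map U" "velocity U = u" "integral {0..2 * pi} U = 0" "\<And>t. norm (U t) \<le> 2 * M"
    using periodic_antiderivative[OF assms] by blast
  then show ?case by (intro exI[of _ U]) (simp add: nth_derivative_Suc)
next
  case (Suc n)
  then obtain U where U: "smooth_circle_map U" "nth_derivative (Suc n) U = u" "integral {0..2 * pi} U = 0"
    "\<And>j t. j \<le> n \<Longrightarrow> norm (nth_derivative j U t) \<le> 2 * (4 * pi) ^ n * M"
    by blast
  define C where "C = 2 * (4 * pi) ^ n * M"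
  have C: "norm (U t) \<le> C" for t using U(4)[of 0] by (simp add: C_def)
  then have "C \<ge> 0" using norm_ge_zero order_trans by blast
  have "norm (integral {0..t} U) \<le> 2 * pi * C" if "t \<in> {0..2 * pi}" for t
  proof -
    have "norm (integral {0..t} U) \<le> C * (t - 0)"
      using C that
      by (intro integral_bound continuous_on_subset[OF smooth_on_imp_continuous_on[OF smooth_circle_map_smooth[OF U(1)]]]) auto
    also have "\<dots> \<le> C * (2 * pi)" using that \<open>C \<ge> 0\<close> by (intro mult_left_mono) auto
    finally show ?thesis by (simp add: mult.commute)
  qed
  then obtain W where W: "smooth_circle_map W" "velocity W = U" "integral {0..2 * pi} W = 0"
      "\<And>t. norm (W t) \<le> 2 * (2 * pi * C)"
    using periodic_antiderivative[OF U(1,3)] by metis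
  have "norm (nth_derivative j W t) \<le> 2 * (4 * pi) ^ Suc n * M" if "j \<le> Suc n" for j t
  proof (cases j)
    case 0
    then show ?thesis using W(4)[of t] by (simp add: C_def mult_ac)
  next
    case (Suc i)
    have "norm (nth_derivative j W t) \<le> C"
      using U(4)[of i t] that Suc by (simp add: nth_derivative_Suc' W(2) C_def)
    also have "\<dots> \<le> (4 * pi) * C"
      using \<open>C \<ge> 0\<close> pi_gt3 mult_right_mono[of 1 "4 * pi" C] by linarith
    finally show ?thesis by (simp add: C_def mult_ac)
  qed
  then show ?case
    using W U(2) by (intro exI[of _ W]) (auto simp: nth_derivative_Suc'[of "Suc n"])
qed

section \<open>Moving knots by shears\<close>

lemma knot_diffeomorphism:
  assumes f: "parametrises_a_knot f" and \<Psi>: "diffeomorphism \<Psi>"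
  shows "parametrises_a_knot (\<lambda>t. \<Psi> (f t))"
proof -
  have scm: "smooth_circle_map f" using f by (rule knot_smooth_circle_map)
  have sm: "smooth_on \<Psi> UNIV" "smooth_on (inv \<Psi>) UNIV" and bij: "bij \<Psi>"
    using \<Psi> by (auto simp: diffeomorphism_def)
  have scm': "smooth_circle_map (\<lambda>t. \<Psi> (f t))"
    unfolding smooth_circle_map_def using smooth_circle_map_periodic[OF scm]
    by (auto intro: smooth_on_compose[OF sm(1) smooth_circle_map_smooth[OF scm]])
  have "velocity (\<lambda>t. \<Psi> (f t)) t \<noteq> 0" for t
  proof
    assume 0: "velocity (\<lambda>t. \<Psi> (f t)) t = 0"
    have "((\<lambda>t. \<Psi> (f t)) has_derivative (\<lambda>v. 0)) (at t)"
      using smooth_circle_map_has_velocity[OF scm', of t UNIV] unfolding 0 by (simp add: has_vector_derivative_def)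
    from has_derivative_compose[OF this smooth_on_has_derivative[OF sm(2) UNIV_I]]
    have "((\<lambda>t. inv \<Psi> (\<Psi> (f t))) has_derivative (\<lambda>v. frechet_derivative (inv \<Psi>) (at (\<Psi> (f t))) 0)) (at t)" .
    moreover have "frechet_derivative (inv \<Psi>) (at (\<Psi> (f t))) 0 = 0"
      using smooth_on_has_derivative[OF sm(2) UNIV_I] has_derivative_linear linear_0 by blast
    ultimately have "(f has_vector_derivative 0) (at t)"
      using bij by (simp add: bij_is_inj has_vector_derivative_def)
    then have "velocity f t = 0" by (rule vector_derivative_at)
    then show False using f by (simp add: parametrises_a_knot_def)
  qed
  moreover have "inj_on (\<lambda>t. \<Psi> (f t)) {0..<2 * pi}"
    using f by (simp add: parametrises_a_knot_def inj_on_def inj_eq[OF bij_is_inj[OF bij]])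
  ultimately show ?thesis using scm' by (simp add: parametrises_a_knot_def)
qed

lemma knot_directional_move:
  fixes D :: "real^3 \<Rightarrow> real"
  assumes f: "parametrises_a_knot f"
    and D: "smooth_on D UNIV" "\<And>x. frechet_derivative D (at x) e = 0"
  shows "parametrises_a_knot (\<lambda>t. f t + D (f t) *\<^sub>R e)"
    and "ambient_isotopic (range (\<lambda>t. f t + D (f t) *\<^sub>R e)) (range f)"
proof -
  show "parametrises_a_knot (\<lambda>t. f t + D (f t) *\<^sub>R e)"
    by (rule knot_diffeomorphism[OF f diffeomorphism_directional_move]) (simp_all add: D)
  have "ambient_isotopic (range f) ((\<lambda>x. x + D x *\<^sub>R e) ` range f)"
    by (rule ambient_isotopic_directional_move) (simp_all add: D)
  then show "ambient_isotopic (range (\<lambda>t. f t + D (f t) *\<^sub>R e)) (range f)"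
    by (simp add: image_image ambient_isotopic_sym)
qed

lemma knot_translate:
  assumes f: "parametrises_a_knot f"
  shows "parametrises_a_knot (\<lambda>t. f t + e)" "ambient_isotopic (range (\<lambda>t. f t + e)) (range f)"
proof -
  have "smooth_on (\<lambda>x::real^3. 1::real) UNIV" by (intro smooth_intros) auto
  moreover have "frechet_derivative (\<lambda>x::real^3. 1::real) (at x) e = 0" for x by simp
  ultimately show "parametrises_a_knot (\<lambda>t. f t + e)" "ambient_isotopic (range (\<lambda>t. f t + e)) (range f)"
    using knot_directional_move[OF f, of "\<lambda>x. 1" e] by simp_all
qed

lemma knot_shear:
  assumes f: "parametrises_a_knot f" and w: "smooth_on w UNIV" and "i \<noteq> j"
  shows "parametrises_a_knot (\<lambda>t. f t + w (f t $ i) *\<^sub>R axis j 1)"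
    and "ambient_isotopic (range (\<lambda>t. f t + w (f t $ i) *\<^sub>R axis j 1)) (range f)"
proof -
  define D where "D = (\<lambda>x::real^3. w (x $ i))"
  have D: "smooth_on D UNIV"
    unfolding D_def
    by (rule smooth_on_compose[OF w smooth_on_linear[OF bounded_linear_vec_nth open_UNIV]]) auto
  have "frechet_derivative D (at x) (axis j 1) = 0" for x
  proof -
    have "((\<lambda>x::real^3. x $ i) has_derivative (\<lambda>v. v $ i)) (at x)"
      by (rule bounded_linear_imp_has_derivative[OF bounded_linear_vec_nth])
    from has_derivative_compose[OF this smooth_on_has_derivative[OF w UNIV_I]]
    have dD: "(D has_derivative (\<lambda>v. frechet_derivative w (at (x $ i)) (v $ i))) (at x)"
      unfolding D_def .
    have "frechet_derivative w (at (x $ i)) 0 = 0"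
      using smooth_on_has_derivative[OF w UNIV_I] has_derivative_linear linear_0 by blast
    then show ?thesis
      using \<open>i \<noteq> j\<close> by (simp add: frechet_derivative_at[OF dD, symmetric] axis_def)
  qed
  from knot_directional_move[OF f D this]
  show "parametrises_a_knot (\<lambda>t. f t + w (f t $ i) *\<^sub>R axis j 1)"
    "ambient_isotopic (range (\<lambda>t. f t + w (f t $ i) *\<^sub>R axis j 1)) (range f)"
    by (auto simp: D_def)
qed

lemma smooth_interpolation:
  fixes f :: "real \<Rightarrow> real"
  assumes "finite X"
  obtains w where "smooth_on w UNIV" "\<And>x. x \<in> X \<Longrightarrow> w x = f x"
proof -
  have "\<exists>z w. smooth_on z UNIV \<and> smooth_on w UNIV \<and> (\<forall>x::real. z x = (0::real) \<longleftrightarrow> x \<in> X) \<and> (\<forall>x\<in>X. w x = f x)"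
    using assms
  proof (induction X)
    case empty
    show ?case by (rule exI[of _ "\<lambda>x. 1"]) (auto intro: smooth_on_const)
  next
    case (insert a X)
    then obtain z w :: "real \<Rightarrow> real" where zw: "smooth_on z UNIV" "smooth_on w UNIV" "\<forall>x. z x = 0 \<longleftrightarrow> x \<in> X" "\<forall>x\<in>X. w x = f x"
      by blast
    have "smooth_on (\<lambda>x. z x * (x - a)) UNIV" "smooth_on (\<lambda>x. w x + z x * ((f a - w a) / z a)) UNIV"
      by (intro smooth_intros zw open_UNIV)+
    moreover have "w a + z a * ((f a - w a) / z a) = f a"
      using zw(3) insert.hyps by simp
    ultimately show ?case
      using zw(3,4) by (intro exI[of _ "\<lambda>x. z x * (x - a)"] exI[of _ "\<lambda>x. w x + z x * ((f a - w a) / z a)"]) auto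
  qed
  then show thesis using that by blast
qed

text \<open>As the \<open>i\<close>-th coordinates tell the points apart, the required displacements are values of an
  interpolating function of the \<open>i\<close>-th coordinate, and the shear by this function produces them.\<close>

lemma knot_adjust_coordinate:
  fixes a :: "nat \<Rightarrow> real"
  assumes f: "parametrises_a_knot f" and "i \<noteq> j" and inj: "inj_on (\<lambda>m. f (s m) $ i) {..<N}"
  obtains g where "parametrises_a_knot g" "ambient_isotopic (range g) (range f)"
    "\<And>t l. l \<noteq> j \<Longrightarrow> g t $ l = f t $ l" "\<And>m. m < N \<Longrightarrow> g (s m) $ j = a m"
proof -
  define X where "X = (\<lambda>m. f (s m) $ i) ` {..<N}"
  define val where "val = (\<lambda>x. let m = inv_into {..<N} (\<lambda>m. f (s m) $ i) x in a m - f (s m) $ j)"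
  obtain w where w: "smooth_on w UNIV" "\<And>x. x \<in> X \<Longrightarrow> w x = val x"
    using smooth_interpolation[of X val] by (auto simp: X_def)
  have "w (f (s m) $ i) = a m - f (s m) $ j" if "m < N" for m
  proof -
    have "inv_into {..<N} (\<lambda>m. f (s m) $ i) (f (s m) $ i) = m"
      using inv_into_f_f[OF inj, of m] that by simp
    then show ?thesis using w(2)[of "f (s m) $ i"] that by (simp add: X_def val_def Let_def)
  qed
  then show thesis
    using knot_shear[OF f w(1) \<open>i \<noteq> j\<close>]
    by (intro that[of "\<lambda>t. f t + w (f t $ i) *\<^sub>R axis j 1"]) (auto simp: axis_def)
qed

text \<open>A coordinate with nonzero velocity at \<open>0\<close> distinguishes the points of a short arc. Points on
  this arc are moved to the targets by adjusting first the two other coordinates and finally, by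
  means of one of these, the distinguishing coordinate.\<close>

lemma knot_through_points:
  fixes p :: "nat \<Rightarrow> real^3"
  assumes f: "parametrises_a_knot f" and p: "\<And>i. inj_on (\<lambda>m. p m $ i) {..<N}"
  obtains g s where "parametrises_a_knot g" "ambient_isotopic (range g) (range f)"
    "\<And>m n. m < n \<Longrightarrow> s m < s n" "\<And>m. 0 < s m \<and> s m < 2 * pi" "\<And>m. m < N \<Longrightarrow> g (s m) = p m"
proof -
  have scm: "smooth_circle_map f" using f by (rule knot_smooth_circle_map)
  obtain i where i: "velocity f 0 $ i \<noteq> 0"
    using f by (auto simp: parametrises_a_knot_def vec_eq_iff)
  have cont: "continuous_on UNIV (\<lambda>t. velocity f t $ i)"
    by (intro continuous_intros smooth_on_imp_continuous_on[OF smooth_circle_map_smooth[OF smooth_circle_map_velocity[OF scm]]])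
  have "open {t. velocity f t $ i \<noteq> 0}"
    by (rule open_Collect_neq[OF cont continuous_on_const])
  moreover have "0 \<in> {t. velocity f t $ i \<noteq> 0}" using i by simp
  ultimately obtain d where d: "d > 0" "ball 0 d \<subseteq> {t. velocity f t $ i \<noteq> 0}"
    by (rule openE)
  define \<delta> where "\<delta> = min d (2 * pi)"
  have "\<delta> > 0" using d by (simp add: \<delta>_def)
  have arc: "f x $ i \<noteq> f y $ i" if xy: "0 < x" "x < y" "y < \<delta>" for x y
  proof
    assume eq: "f x $ i = f y $ i"
    have der: "((\<lambda>t. f t $ i) has_real_derivative velocity f t $ i) (at t)" for t
      unfolding has_real_derivative_iff_has_vector_derivative
      by (intro bounded_linear.has_vector_derivative[OF bounded_linear_vec_nth] smooth_circle_map_has_velocity[OF scm])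
    obtain z where "z > x" "z < y" "f y $ i - f x $ i = (y - x) * velocity f z $ i"
      using MVT2[OF xy(2), of "\<lambda>t. f t $ i" "\<lambda>t. velocity f t $ i"] der by blast
    then have "velocity f z $ i = 0" "z \<in> ball 0 d" using eq xy by (auto simp: \<delta>_def dist_real_def)
    then show False using d by blast
  qed
  define s where "s = (\<lambda>m::nat. \<delta> * (1 - 1 / (real m + 2)))"
  have s_mono: "s m < s n" if "m < n" for m n
    using that \<open>\<delta> > 0\<close> by (simp add: s_def frac_less2)
  have s_bounds: "0 < s m" "s m < \<delta>" for m
    using \<open>\<delta> > 0\<close> by (auto simp: s_def mult_less_cancel_left1)
  have inj: "inj_on (\<lambda>m. f (s m) $ i) {..<N}"
  proof (rule inj_onI)
    show "m = n" if "f (s m) $ i = f (s n) $ i" for m n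
      using that arc[of "s m" "s n"] arc[of "s n" "s m"] s_mono[of m n] s_mono[of n m] s_bounds
      by (cases m n rule: linorder_cases) auto
  qed
  obtain j k where jk: "j \<noteq> i" "k \<noteq> i" "j \<noteq> k" and all: "\<And>l. l = i \<or> l = j \<or> l = (k::3)"
  proof -
    have "\<exists>j k. j \<noteq> i \<and> k \<noteq> i \<and> j \<noteq> k \<and> (\<forall>l. l = i \<or> l = j \<or> l = (k::3))"
    proof -
      consider "i = 1" | "i = 2" | "i = 3" using exhaust_3 by blast
      then show ?thesis
      proof cases
        case 1 show ?thesis by (rule exI[of _ 2], rule exI[of _ 3]) (simp add: 1 forall_3)
      next
        case 2 show ?thesis by (rule exI[of _ 1], rule exI[of _ 3]) (simp add: 2 forall_3)
      next
        case 3 show ?thesis by (rule exI[of _ 1], rule exI[of _ 2]) (simp add: 3 forall_3)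
      qed
    qed
    then show thesis using that by blast
  qed
  obtain g1 where g1: "parametrises_a_knot g1" "ambient_isotopic (range g1) (range f)"
    "\<And>t l. l \<noteq> j \<Longrightarrow> g1 t $ l = f t $ l" "\<And>m. m < N \<Longrightarrow> g1 (s m) $ j = p m $ j"
    using knot_adjust_coordinate[OF f jk(1)[symmetric] inj, of "\<lambda>m. p m $ j"] by blast
  have inj1: "inj_on (\<lambda>m. g1 (s m) $ i) {..<N}" using inj g1(3)[of i] jk by simp
  obtain g2 where g2: "parametrises_a_knot g2" "ambient_isotopic (range g2) (range g1)"
    "\<And>t l. l \<noteq> k \<Longrightarrow> g2 t $ l = g1 t $ l" "\<And>m. m < N \<Longrightarrow> g2 (s m) $ k = p m $ k"
    using knot_adjust_coordinate[OF g1(1) jk(2)[symmetric] inj1, of "\<lambda>m. p m $ k"] by blast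
  have "g2 (s m) $ j = p m $ j" if "m < N" for m using g1(4)[OF that] g2(3)[of j] jk by simp
  then have inj2: "inj_on (\<lambda>m. g2 (s m) $ j) {..<N}" using p[of j] by (simp add: inj_on_def)
  obtain g3 where g3: "parametrises_a_knot g3" "ambient_isotopic (range g3) (range g2)"
    "\<And>t l. l \<noteq> i \<Longrightarrow> g3 t $ l = g2 t $ l" "\<And>m. m < N \<Longrightarrow> g3 (s m) $ i = p m $ i"
    using knot_adjust_coordinate[OF g2(1) jk(1) inj2, of "\<lambda>m. p m $ i"] by blast
  show thesis
  proof (rule that[of g3 s])
    show "ambient_isotopic (range g3) (range f)"
      using g1(2) g2(2) g3(2) ambient_isotopic_trans by blast
    show "g3 (s m) = p m" if "m < N" for m
    proof -
      have "g3 (s m) $ l = p m $ l" for l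
        using all[of l] jk g1(3,4) g2(3,4) g3(3,4) that by (metis (no_types))
      then show ?thesis by (simp add: vec_eq_iff)
    qed
  qed (use g3 s_mono s_bounds in \<open>auto simp: \<delta>_def\<close>)
qed

section \<open>Parametrisations that rest at prescribed points\<close>

text \<open>The lift of a circle diffeomorphism whose derivative is the Poisson kernel
  \<open>(1 - r\<^sup>2) / (1 - 2 r cos t + r\<^sup>2)\<close>. For \<open>r \<longlonglongrightarrow> 1\<close> it converges to a step function with jumps at the
  multiples of \<open>2\<pi>\<close>.\<close>

definition poisson_step :: "real \<Rightarrow> real \<Rightarrow> real" where
  "poisson_step r t = t + 2 * arctan (r * sin t / (1 - r * cos t))"

lemma poisson_denominator:
  assumes "0 \<le> r" "r < 1" shows "1 - r * cos t > (0::real)"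
proof -
  have "r * cos t \<le> r * 1" using assms by (intro mult_left_mono) auto
  then show ?thesis using assms by simp
qed

lemma smooth_on_poisson_step:
  assumes "0 \<le> r" "r < 1" shows "smooth_on (poisson_step r) UNIV"
  unfolding poisson_step_def
  using poisson_denominator[OF assms] by (intro smooth_intros) (auto simp: less_le)

lemma poisson_step_shift: "poisson_step r (t + 2 * pi) = poisson_step r t + 2 * pi"
  by (simp add: poisson_step_def)

lemma poisson_step_has_derivative:
  assumes "0 \<le> r" "r < 1"
  shows "(poisson_step r has_real_derivative (1 - r\<^sup>2) / (1 - 2 * r * cos t + r\<^sup>2)) (at t)"
    and "(1 - r\<^sup>2) / (1 - 2 * r * cos t + r\<^sup>2) > 0"
proof -
  define q where "q = 1 - r * cos t"
  define n where "n = r * sin t"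
  have q: "q > 0" using poisson_denominator[OF assms] by (simp add: q_def)
  have pos: "q\<^sup>2 + n\<^sup>2 > 0" using q by (simp add: add_pos_nonneg)
  have denom: "1 - 2 * r * cos t + r\<^sup>2 = q\<^sup>2 + n\<^sup>2"
    using sin_cos_squared_add[of t] unfolding q_def n_def by algebra
  have "((\<lambda>t. r * sin t / (1 - r * cos t)) has_real_derivative (r * cos t * q - n * n) / (q * q)) (at t)"
    using q by (auto intro!: derivative_eq_intros simp: q_def n_def)
  then have "(poisson_step r has_real_derivative 1 + 2 * (((r * cos t * q - n * n) / (q * q)) * inverse (1 + (n / q)\<^sup>2))) (at t)"
    unfolding poisson_step_def
    using q by (auto intro!: derivative_eq_intros DERIV_chain2[OF DERIV_arctan] simp: q_def n_def)
  moreover have "1 + 2 * (((r * cos t * q - n * n) / (q * q)) * inverse (1 + (n / q)\<^sup>2))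
      = (1 - r\<^sup>2) / (q\<^sup>2 + n\<^sup>2)"
  proof -
    have "1 + (n / q)\<^sup>2 = (q\<^sup>2 + n\<^sup>2) / (q * q)" using q by (simp add: field_simps power2_eq_square)
    then have eq: "((r * cos t * q - n * n) / (q * q)) * inverse (1 + (n / q)\<^sup>2) = (r * cos t * q - n * n) / (q\<^sup>2 + n\<^sup>2)"
      using q by simp
    have num: "q\<^sup>2 + n\<^sup>2 + 2 * (r * cos t * q - n * n) = 1 - r\<^sup>2"
      using sin_cos_squared_add[of t] unfolding q_def n_def by algebra
    have "1 + 2 * ((r * cos t * q - n * n) / (q\<^sup>2 + n\<^sup>2)) = (q\<^sup>2 + n\<^sup>2 + 2 * (r * cos t * q - n * n)) / (q\<^sup>2 + n\<^sup>2)"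
      using q by (simp add: add_divide_distrib)
    then show ?thesis unfolding eq num .
  qed
  ultimately show "(poisson_step r has_real_derivative (1 - r\<^sup>2) / (1 - 2 * r * cos t + r\<^sup>2)) (at t)"
    by (simp add: denom)
  show "(1 - r\<^sup>2) / (1 - 2 * r * cos t + r\<^sup>2) > 0"
    unfolding denom using pos assms by (simp add: power_less_one_iff abs_square_less_1)
qed

lemma poisson_step_tendsto:
  assumes t: "0 < t" "t < 2 * pi" and r: "r \<longlonglongrightarrow> 1"
  shows "(\<lambda>n. poisson_step (r n) t) \<longlonglongrightarrow> pi"
proof -
  have s: "sin (t / 2) > 0" using t by (intro sin_gt_zero) auto
  have c: "1 - cos t = 2 * (sin (t / 2))\<^sup>2" using cos_double_sin[of "t / 2"] by simp
  have "(\<lambda>n. poisson_step (r n) t) \<longlonglongrightarrow> t + 2 * arctan (1 * sin t / (1 - 1 * cos t))"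
    unfolding poisson_step_def using s by (intro tendsto_intros r) (simp add: c)
  moreover have "sin t / (1 - cos t) = tan (pi / 2 - t / 2)"
  proof -
    have "sin t = 2 * sin (t / 2) * cos (t / 2)" using sin_double[of "t / 2"] by simp
    then have "sin t / (1 - cos t) = cos (t / 2) / sin (t / 2)"
      using s by (simp add: c power2_eq_square)
    also have "\<dots> = tan (pi / 2 - t / 2)" by (simp add: tan_def cos_diff sin_diff)
    finally show ?thesis .
  qed
  moreover have "arctan (tan (pi / 2 - t / 2)) = pi / 2 - t / 2"
    using t by (intro arctan_tan) auto
  ultimately show ?thesis by simp
qed

lemma poisson_step_tendsto_neg:
  assumes t: "- 2 * pi < t" "t < 0" and r: "r \<longlonglongrightarrow> 1"
  shows "(\<lambda>n. poisson_step (r n) t) \<longlonglongrightarrow> - pi"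
proof -
  have "(\<lambda>n. poisson_step (r n) (t + 2 * pi) - 2 * pi) \<longlonglongrightarrow> pi - 2 * pi"
    using t by (intro tendsto_intros poisson_step_tendsto r) auto
  then show ?thesis by (simp add: poisson_step_shift)
qed

lemma knot_reparametrise:
  assumes f: "parametrises_a_knot f"
    and \<theta>: "smooth_on \<theta> UNIV" "\<And>t. (\<theta> has_real_derivative \<theta>' t) (at t)" "\<And>t. \<theta>' t > 0"
      "\<And>t. \<theta> (t + 2 * pi) = \<theta> t + 2 * pi"
  shows "parametrises_a_knot (\<lambda>t. f (\<theta> t))" "range (\<lambda>t. f (\<theta> t)) = range f"
proof -
  have scm: "smooth_circle_map f" using f by (rule knot_smooth_circle_map)
  have shift: "\<theta> (t + 2 * pi * real_of_int k) = \<theta> t + 2 * pi * real_of_int k" for t k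
    using periodic_shift_int[of "\<lambda>t. \<theta> t - t" t k] \<theta>(4) by (simp add: algebra_simps)
  have mono: "\<theta> s < \<theta> t" if "s < t" for s t
    using DERIV_pos_imp_increasing[OF that, of \<theta>] \<theta>(2,3) by blast
  then have inj: "s = t" if "\<theta> s = \<theta> t" for s t
    using that by (cases s t rule: linorder_cases) (auto dest: mono)
  have "smooth_circle_map (\<lambda>t. f (\<theta> t))"
    unfolding smooth_circle_map_def \<theta>(4) smooth_circle_map_periodic[OF scm]
    using smooth_on_compose[OF smooth_circle_map_smooth[OF scm] \<theta>(1)] by auto
  moreover have "velocity (\<lambda>t. f (\<theta> t)) t \<noteq> 0" for t
  proof -
    have "(\<theta> has_vector_derivative \<theta>' t) (at t)"
      using \<theta>(2) by (simp add: has_real_derivative_iff_has_vector_derivative)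
    from vector_diff_chain_at[OF this smooth_circle_map_has_velocity[OF scm]]
    have "velocity (\<lambda>t. f (\<theta> t)) t = \<theta>' t *\<^sub>R velocity f (\<theta> t)"
      by (simp add: vector_derivative_at comp_def)
    then show ?thesis using \<theta>(3)[of t] f by (auto simp: parametrises_a_knot_def)
  qed
  moreover have "s = t" if st: "s \<in> {0..<2 * pi}" "t \<in> {0..<2 * pi}" "f (\<theta> s) = f (\<theta> t)" for s t
  proof -
    obtain k :: int where "\<theta> s = \<theta> t + 2 * pi * real_of_int k" using knot_eq_imp[OF f st(3)] by blast
    then have "\<theta> s = \<theta> (t + 2 * pi * real_of_int k)" by (simp add: shift)
    then have k: "s = t + 2 * pi * real_of_int k" by (rule inj)
    then have "2 * pi * \<bar>real_of_int k\<bar> = \<bar>s - t\<bar>" by (simp add: abs_mult)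
    also have "\<dots> < 2 * pi * 1" using st by auto
    finally have "\<bar>real_of_int k\<bar> < 1" using mult_less_cancel_left_pos[of "2 * pi"] by simp
    then have "k = 0" by linarith
    then show ?thesis using k by simp
  qed
  ultimately show "parametrises_a_knot (\<lambda>t. f (\<theta> t))"
    by (auto simp: parametrises_a_knot_def inj_on_def)
  have "y \<in> range \<theta>" for y
  proof -
    obtain s and k :: int where s: "s \<in> {0..<2 * pi}" "y - \<theta> 0 = s + 2 * pi * real_of_int k"
      by (rule circle_representative)
    have "\<exists>x\<ge>0. x \<le> 2 * pi \<and> \<theta> x = \<theta> 0 + s"
    proof (rule IVT')
      show "\<theta> 0 + s \<le> \<theta> (2 * pi)" using \<theta>(4)[of 0] s(1) by simp
      show "continuous_on {0..2 * pi} \<theta>"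
        using smooth_on_imp_continuous_on[OF \<theta>(1)] continuous_on_subset by blast
    qed (use s(1) in auto)
    then obtain x where "\<theta> x = \<theta> 0 + s" by blast
    then have "\<theta> (x + 2 * pi * real_of_int k) = y" using s(2) by (simp add: shift)
    then show ?thesis by blast
  qed
  then show "range (\<lambda>t. f (\<theta> t)) = range f" by (auto simp: image_iff) metis
qed

section \<open>Every knot type is dense in the mean\<close>

text \<open>Choose points \<open>p m\<close> close to a fine subdivision of \<open>\<gamma>\<close>, a knot of the required type through
  them, and parametrisations of this knot that converge pointwise to the step function with values
  \<open>p m\<close>: the knot hurries from each point to the next one. By dominated convergence they converge
  in the mean, however long the knot is between two points.\<close>

lemma knot_L1_approximation:
  assumes \<gamma>: "smooth_circle_map \<gamma>" and f: "parametrises_a_knot f" and "\<epsilon> > 0"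
  obtains g where "parametrises_a_knot g" "ambient_isotopic (range g) (range f)"
    "integral {0..2 * pi} (\<lambda>t. norm (g t - \<gamma> t)) < \<epsilon>"
proof -
  have cont\<gamma>: "continuous_on A \<gamma>" for A
    using smooth_on_imp_continuous_on[OF smooth_circle_map_smooth[OF \<gamma>]] continuous_on_subset by blast
  define e where "e = \<epsilon> / (8 * pi)"
  have "e > 0" using \<open>\<epsilon> > 0\<close> by (simp add: e_def)
  have "uniformly_continuous_on {0..2 * pi} \<gamma>"
    by (intro compact_uniformly_continuous cont\<gamma>) auto
  then obtain d where d: "d > 0"
    "\<And>s t. s \<in> {0..2 * pi} \<Longrightarrow> t \<in> {0..2 * pi} \<Longrightarrow> dist s t < d \<Longrightarrow> dist (\<gamma> s) (\<gamma> t) < e"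
    unfolding uniformly_continuous_on_def using \<open>e > 0\<close> by metis
  define N where "N = nat \<lceil>2 * pi / d\<rceil> + 1"
  have "N > 0" by (simp add: N_def)
  have "2 * pi / d < real N" by (simp add: N_def) linarith
  then have Nd: "2 * pi / real N < d" using d(1) \<open>N > 0\<close> by (simp add: field_simps)
  define a where "a = (\<lambda>m. 2 * pi * real m / real N)"
  have a_mono: "a m \<le> a n" if "m \<le> n" for m n
    using that by (simp add: a_def divide_right_mono)
  have a_ends: "a 0 = 0" "a N = 2 * pi" using \<open>N > 0\<close> by (auto simp: a_def)
  have a_Suc: "a (Suc k) = a k + 2 * pi / real N" for k by (simp add: a_def add_divide_distrib distrib_left)
  \<comment> \<open>Shifting the point with index \<open>m\<close> by \<open>x * m\<close> makes all coordinates distinct, except for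
    finitely many \<open>x\<close>.\<close>
  define bad where "bad = (\<lambda>(m, n, i). (\<gamma> (a n) $ i - \<gamma> (a m) $ i) / (real m - real n)) ` ({..<N} \<times> {..<N} \<times> (UNIV :: 3 set))"
  have "finite bad" unfolding bad_def by (intro finite_imageI finite_cartesian_product) auto
  define c1 where "c1 = real N * norm (1 :: real^3) + 1"
  have "c1 > 0" by (simp add: c1_def add_nonneg_pos)
  then have "infinite {0<..<e / c1}" using \<open>e > 0\<close> by (simp add: infinite_Ioo)
  then obtain x where x: "x \<in> {0<..<e / c1}" "x \<notin> bad"
    using \<open>finite bad\<close> by (meson finite_subset subsetI)
  define p where "p = (\<lambda>m. \<gamma> (a m) + (x * real m) *\<^sub>R (1 :: real^3))"
  have p_inj: "inj_on (\<lambda>m. p m $ i) {..<N}" for i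
  proof (rule inj_onI, rule ccontr)
    fix m n assume mn: "m \<in> {..<N}" "n \<in> {..<N}" "p m $ i = p n $ i" "m \<noteq> n"
    then have "x * (real m - real n) = \<gamma> (a n) $ i - \<gamma> (a m) $ i"
      by (simp add: p_def algebra_simps)
    then have "x = (\<gamma> (a n) $ i - \<gamma> (a m) $ i) / (real m - real n)"
      using mn(4) by (simp add: eq_divide_eq)
    then have "x \<in> bad" unfolding bad_def using mn by (intro image_eqI[of _ _ "(m, n, i)"]) auto
    then show False using x by simp
  qed
  have p_close: "norm (p m - \<gamma> (a m)) \<le> e" if "m < N" for m
  proof -
    have "norm (p m - \<gamma> (a m)) = x * (real m * norm (1 :: real^3))" using x by (simp add: p_def)
    also have "\<dots> \<le> e / c1 * c1"
      using x that \<open>e > 0\<close> \<open>c1 > 0\<close> unfolding c1_def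
      by (intro mult_mono add_increasing2 mult_right_mono) auto
    finally show ?thesis using \<open>c1 > 0\<close> by simp
  qed
  obtain g s where g: "parametrises_a_knot g" "ambient_isotopic (range g) (range f)"
    and s: "\<And>m n. m < n \<Longrightarrow> s m < s n" "\<And>m. 0 < s m \<and> s m < 2 * pi" "\<And>m. m < N \<Longrightarrow> g (s m) = p m"
    by (rule knot_through_points[OF f p_inj]) blast
  have scm: "smooth_circle_map g" using g(1) by (rule knot_smooth_circle_map)
  have contg: "continuous_on UNIV g"
    using smooth_on_imp_continuous_on[OF smooth_circle_map_smooth[OF scm]] .
  \<comment> \<open>The limit of \<open>\<theta> n\<close> jumps by \<open>w m\<close> at \<open>a m\<close>; the jump at \<open>a 0\<close> leads from \<open>s (N - 1) - 2 \<pi>\<close>,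
    which is \<open>s (N - 1)\<close> on the circle, to \<open>s 0\<close>. The constant \<open>c\<close> gives the limit the value \<open>s 0\<close> between \<open>a 0\<close> and \<open>a 1\<close>.\<close>
  define w where "w = (\<lambda>m. if m = 0 then 2 * pi - (s (N - 1) - s 0) else s m - s (m - 1))"
  have w_pos: "w m > 0" for m
    using s(1)[of "m - 1" m] s(2)[of "N - 1"] s(2)[of 0] by (auto simp: w_def)
  have w_sum: "(\<Sum>m\<le>k. w m) = w 0 + s k - s 0" for k
    by (induction k) (auto simp: w_def)
  have w_total: "(\<Sum>m<N. w m) = 2 * pi"
    using w_sum[of "N - 1"] \<open>N > 0\<close> by (simp add: lessThan_Suc_atMost[symmetric] w_def)
  define c where "c = s 0 + pi - w 0"
  define r where "r = (\<lambda>n::nat. 1 - 1 / (real n + 2))"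
  have r: "0 \<le> r n" "r n < 1" for n by (auto simp: r_def)
  have r_lim: "r \<longlonglongrightarrow> 1"
  proof -
    have "(\<lambda>n. 1 - inverse (real (Suc (Suc n)))) \<longlonglongrightarrow> 1 - 0"
      by (intro tendsto_intros filterlim_compose[OF LIMSEQ_inverse_real_of_nat filterlim_Suc])
    then show ?thesis by (simp add: r_def divide_inverse add.commute)
  qed
  define \<theta> where "\<theta> = (\<lambda>n t. c + (\<Sum>m<N. w m / (2 * pi) * poisson_step (r n) (t - a m)))"
  define \<theta>' where "\<theta>' = (\<lambda>n t. \<Sum>m<N. w m / (2 * pi) * ((1 - (r n)\<^sup>2) / (1 - 2 * r n * cos (t - a m) + (r n)\<^sup>2)))"
  have \<theta>_smooth: "smooth_on (\<theta> n) UNIV" for n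
    unfolding \<theta>_def
    by (intro smooth_intros smooth_on_compose[OF smooth_on_poisson_step[OF r]]) auto
  have \<theta>_deriv: "(\<theta> n has_real_derivative \<theta>' n t) (at t)" for n t
  proof -
    have "((\<lambda>t. poisson_step (r n) (t - a m)) has_real_derivative
        ((1 - (r n)\<^sup>2) / (1 - 2 * r n * cos (t - a m) + (r n)\<^sup>2)) * 1) (at t)" for m
      by (rule DERIV_chain2[OF poisson_step_has_derivative(1)[OF r]]) (auto intro!: derivative_eq_intros)
    then show ?thesis
      unfolding \<theta>_def \<theta>'_def by (auto intro!: derivative_eq_intros sum.cong)
  qed
  have \<theta>'_pos: "\<theta>' n t > 0" for n t
    unfolding \<theta>'_def using \<open>N > 0\<close> w_pos poisson_step_has_derivative(2)[OF r]
    by (intro sum_pos mult_pos_pos) auto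
  have \<theta>_shift: "\<theta> n (t + 2 * pi) = \<theta> n t + 2 * pi" for n t
  proof -
    have "poisson_step (r n) (t + 2 * pi - a m) = poisson_step (r n) (t - a m) + 2 * pi" for m
      using poisson_step_shift[of "r n" "t - a m"] by (simp add: algebra_simps)
    then have "\<theta> n (t + 2 * pi) = \<theta> n t + (\<Sum>m<N. w m)"
      by (simp add: \<theta>_def distrib_left add_divide_distrib sum.distrib)
    then show ?thesis by (simp add: w_total)
  qed
  have \<theta>_lim: "(\<lambda>n. \<theta> n t) \<longlonglongrightarrow> s k" if k: "k < N" "a k < t" "t < a (Suc k)" for t k
  proof -
    have "(\<lambda>n. poisson_step (r n) (t - a m)) \<longlonglongrightarrow> (if m \<le> k then pi else - pi)" if "m < N" for m
    proof (cases "m \<le> k")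
      case True
      have "0 < t - a m" "t - a m < 2 * pi"
        using k a_mono[OF True] a_mono[of "Suc k" N] a_mono[of 0 m] a_ends by auto
      then show ?thesis using poisson_step_tendsto[OF _ _ r_lim] True by simp
    next
      case False
      have "a m < a N" using that \<open>N > 0\<close> unfolding a_def by (intro divide_strict_right_mono) auto
      then have "- 2 * pi < t - a m" "t - a m < 0"
        using k False a_mono[of "Suc k" m] a_mono[of 0 k] a_ends by auto
      then show ?thesis using poisson_step_tendsto_neg[OF _ _ r_lim] False by simp
    qed
    then have "(\<lambda>n. \<theta> n t) \<longlonglongrightarrow> c + (\<Sum>m<N. w m / (2 * pi) * (if m \<le> k then pi else - pi))"
      unfolding \<theta>_def by (intro tendsto_intros) auto
    moreover have "(\<Sum>m<N. w m / (2 * pi) * (if m \<le> k then pi else - pi)) = (\<Sum>m\<le>k. w m) - pi"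
    proof -
      have "(\<Sum>m<N. w m / (2 * pi) * (if m \<le> k then pi else - pi)) = (\<Sum>m<N. (if m \<le> k then w m else 0) - w m / 2)"
        by (intro sum.cong) auto
      also have "\<dots> = (\<Sum>m<N. if m \<le> k then w m else 0) - (\<Sum>m<N. w m) / 2"
        by (simp add: sum_subtractf sum_divide_distrib)
      also have "(\<Sum>m<N. if m \<le> k then w m else 0) = (\<Sum>m\<in>{m\<in>{..<N}. m \<le> k}. w m)"
        by (rule sum.inter_filter[symmetric]) simp
      also have "{m\<in>{..<N}. m \<le> k} = {..k}" using k(1) by auto
      finally show ?thesis by (simp add: w_total)
    qed
    ultimately show ?thesis by (simp add: w_sum c_def)
  qed
  define \<eta> where "\<eta> = (\<lambda>n t. g (\<theta> n t))"
  have \<eta>: "parametrises_a_knot (\<eta> n)" "range (\<eta> n) = range g" for n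
    unfolding \<eta>_def
    using knot_reparametrise[OF g(1) \<theta>_smooth \<theta>_deriv \<theta>'_pos \<theta>_shift] by auto
  have cont\<eta>: "continuous_on A (\<eta> n)" for A n
    using smooth_on_imp_continuous_on[OF smooth_circle_map_smooth[OF knot_smooth_circle_map[OF \<eta>(1)]]]
      continuous_on_subset by blast
  have "bounded (range g)" "bounded (range \<gamma>)"
    using compact_range_circle_map[OF scm] compact_range_circle_map[OF \<gamma>] compact_imp_bounded by auto
  then obtain B1 B2 where B: "\<And>t. norm (g t) \<le> B1" "\<And>t. norm (\<gamma> t) \<le> B2"
    unfolding bounded_iff by auto
  \<comment> \<open>At the jumps, which are finitely many, there is no convergence to the step function.\<close>
  define E where "E = a ` {..N}"
  define ix where "ix = (\<lambda>t. nat \<lfloor>t * real N / (2 * pi)\<rfloor>)"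
  have ix: "ix t < N" "a (ix t) < t" "t < a (Suc (ix t))" if t: "t \<in> {0..2 * pi}" "t \<notin> E" for t
  proof -
    have nn: "0 \<le> t * real N / (2 * pi)" using t by simp
    have "real (ix t) \<le> t * real N / (2 * pi)" "t * real N / (2 * pi) < real (ix t) + 1"
      unfolding ix_def using nn by linarith+
    then have le: "a (ix t) \<le> t" and less: "t < a (Suc (ix t))"
      using \<open>N > 0\<close> by (auto simp: a_def field_simps)
    show "t < a (Suc (ix t))" by (rule less)
    have "t \<noteq> a N" using t(2) by (auto simp: E_def)
    then have "t < a N" using t(1) a_ends by simp
    then have "a (ix t) < a N" using le by simp
    then show "ix t < N" using a_mono[of N "ix t"] by (meson not_le)
    then have "t \<noteq> a (ix t)" using t(2) by (auto simp: E_def)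
    then show "a (ix t) < t" using le by simp
  qed
  define F where "F = (\<lambda>n t. if t \<in> E then 0 else norm (\<eta> n t - \<gamma> t))"
  define G where "G = (\<lambda>t. if t \<in> E then 0 else norm (p (ix t) - \<gamma> t))"
  have int0: "(\<lambda>t. norm (\<eta> n t - \<gamma> t)) integrable_on {0..2 * pi}" for n
    by (intro integrable_continuous_interval continuous_intros cont\<eta> cont\<gamma>)
  have "finite E" by (simp add: E_def)
  have intF: "F n integrable_on {0..2 * pi}" "integral {0..2 * pi} (F n) = integral {0..2 * pi} (\<lambda>t. norm (\<eta> n t - \<gamma> t))" for n
    by (rule integrable_spike[OF int0 negligible_finite[OF \<open>finite E\<close>]], simp add: F_def)
       (rule integral_spike[OF negligible_finite[OF \<open>finite E\<close>]], simp add: F_def)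
  have F_bound: "norm (F n t) \<le> B1 + B2" for n t
  proof -
    have "norm (\<eta> n t - \<gamma> t) \<le> B1 + B2"
      using norm_triangle_ineq4[of "\<eta> n t" "\<gamma> t"] B(1)[of "\<theta> n t"] B(2)[of t] by (simp add: \<eta>_def)
    moreover have "0 \<le> B1 + B2" using B norm_ge_zero order_trans add_nonneg_nonneg by meson
    ultimately show ?thesis by (simp add: F_def)
  qed
  have F_lim: "(\<lambda>n. F n t) \<longlonglongrightarrow> G t" if t: "t \<in> {0..2 * pi}" for t
  proof (cases "t \<in> E")
    case False
    have "(\<lambda>n. g (\<theta> n t)) \<longlonglongrightarrow> g (s (ix t))"
      using \<theta>_lim[OF ix[OF t False]] contg by (intro isCont_tendsto_compose[of _ g]) (simp add: continuous_on_eq_continuous_at)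
    then show ?thesis
      using False s(3)[OF ix(1)[OF t False]] by (auto simp: F_def G_def \<eta>_def intro!: tendsto_intros)
  qed (simp add: F_def G_def)
  have G: "G integrable_on {0..2 * pi}" "(\<lambda>n. integral {0..2 * pi} (F n)) \<longlonglongrightarrow> integral {0..2 * pi} G"
    using dominated_convergence[OF intF(1) _ F_bound F_lim] by auto
  have "G t \<le> 2 * e" if t: "t \<in> {0..2 * pi}" for t
  proof (cases "t \<in> E")
    case False
    have "a (ix t) \<in> {0..2 * pi}" "dist (a (ix t)) t < d"
      using ix[OF t False] t a_mono[of 0 "ix t"] a_ends Nd a_Suc[of "ix t"] by (auto simp: dist_real_def)
    then have "norm (\<gamma> (a (ix t)) - \<gamma> t) < e" using d(2) t by (simp add: dist_norm)
    then have "norm (p (ix t) - \<gamma> t) \<le> e + e"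
      using p_close[OF ix(1)[OF t False]] norm_triangle_ineq[of "p (ix t) - \<gamma> (a (ix t))" "\<gamma> (a (ix t)) - \<gamma> t"]
      by simp
    then show ?thesis using False by (simp add: G_def)
  qed (use \<open>e > 0\<close> in \<open>simp add: G_def\<close>)
  then have "integral {0..2 * pi} G \<le> integral {0..2 * pi} (\<lambda>t. 2 * e)"
    by (intro integral_le G(1)) auto
  also have "\<dots> < \<epsilon>" using \<open>\<epsilon> > 0\<close> by (simp add: e_def)
  finally have "integral {0..2 * pi} G < \<epsilon>" .
  then have "\<forall>\<^sub>F n in sequentially. integral {0..2 * pi} (F n) < \<epsilon>"
    by (rule order_tendstoD(2)[OF G(2)])
  then obtain n where "integral {0..2 * pi} (F n) < \<epsilon>"
    using eventually_happens'[OF sequentially_bot] by blast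
  then show thesis
    using that[of "\<eta> n"] \<eta>[of n] g(2) intF(2)[of n] by simp
qed

text \<open>A small translation gives the approximating knot exactly the mean of \<open>\<gamma>\<close>, which is what makes
  the difference a derivative of any order of a smooth loop.\<close>

lemma knot_weak_approximation:
  assumes \<gamma>: "smooth_circle_map \<gamma>" "integral {0..2 * pi} \<gamma> = 0" and f: "parametrises_a_knot f" and "\<epsilon> > 0"
  obtains g where "parametrises_a_knot g" "ambient_isotopic (range g) (range f)"
    "integral {0..2 * pi} (\<lambda>t. g t - \<gamma> t) = 0"
    "\<And>t. t \<in> {0..2 * pi} \<Longrightarrow> norm (integral {0..t} (\<lambda>t. g t - \<gamma> t)) \<le> \<epsilon>"
proof -
  obtain h where h: "parametrises_a_knot h" "ambient_isotopic (range h) (range f)"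
    "integral {0..2 * pi} (\<lambda>t. norm (h t - \<gamma> t)) < \<epsilon> / 2"
    using knot_L1_approximation[OF \<gamma>(1) f, of "\<epsilon> / 2"] \<open>\<epsilon> > 0\<close> by auto
  define \<delta> where "\<delta> = (\<lambda>t. h t - \<gamma> t)"
  have "smooth_circle_map \<delta>"
    unfolding \<delta>_def by (rule smooth_circle_map_diff[OF knot_smooth_circle_map[OF h(1)] \<gamma>(1)])
  then have cont: "continuous_on A \<delta>" for A
    using smooth_on_imp_continuous_on[OF smooth_circle_map_smooth] continuous_on_subset by blast
  have int: "\<delta> integrable_on {0..t}" "(\<lambda>t. norm (\<delta> t)) integrable_on {0..t}" for t
    by (intro integrable_continuous_interval continuous_intros cont)+
  have bound: "norm (integral {0..t} \<delta>) \<le> \<epsilon> / 2" if "t \<in> {0..2 * pi}" for t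
  proof -
    have "norm (integral {0..t} \<delta>) \<le> integral {0..t} (\<lambda>t. norm (\<delta> t))"
      by (rule integral_norm_bound_integral[OF int]) simp
    also have "\<dots> \<le> integral {0..2 * pi} (\<lambda>t. norm (\<delta> t))"
      using that by (intro integral_subset_le int) auto
    finally show ?thesis using h(3) by (simp add: \<delta>_def)
  qed
  define \<mu> where "\<mu> = (1 / (2 * pi)) *\<^sub>R integral {0..2 * pi} \<delta>"
  have \<mu>: "2 * pi * norm \<mu> \<le> \<epsilon> / 2" using bound[of "2 * pi"] by (simp add: \<mu>_def)
  define g where "g = (\<lambda>t. h t + (- \<mu>))"
  have int_g: "integral {0..t} (\<lambda>t. g t - \<gamma> t) = integral {0..t} \<delta> - t *\<^sub>R \<mu>" if "t \<ge> 0" for t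
  proof -
    have "(\<lambda>t. g t - \<gamma> t) = (\<lambda>t. \<delta> t - \<mu>)" by (auto simp: g_def \<delta>_def)
    moreover have "integral {0..t} (\<lambda>t. \<delta> t - \<mu>) = integral {0..t} \<delta> - integral {0..t} (\<lambda>t. \<mu>)"
      by (rule Henstock_Kurzweil_Integration.integral_diff[OF int(1)]) auto
    ultimately show ?thesis using that by simp
  qed
  show thesis
  proof (rule that[of g])
    show "parametrises_a_knot g" unfolding g_def by (rule knot_translate(1)[OF h(1)])
    show "ambient_isotopic (range g) (range f)"
      unfolding g_def using ambient_isotopic_trans[OF knot_translate(2)[OF h(1)] h(2)] .
    show "integral {0..2 * pi} (\<lambda>t. g t - \<gamma> t) = 0"
      by (simp add: int_g \<mu>_def)
    fix t assume t: "t \<in> {0..2 * pi}"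
    have "norm (integral {0..t} (\<lambda>t. g t - \<gamma> t)) \<le> norm (integral {0..t} \<delta>) + t * norm \<mu>"
      using t norm_triangle_ineq4[of "integral {0..t} \<delta>" "t *\<^sub>R \<mu>"] by (simp add: int_g)
    also have "t * norm \<mu> \<le> 2 * pi * norm \<mu>" using t by (intro mult_right_mono) auto
    finally show "norm (integral {0..t} (\<lambda>t. g t - \<gamma> t)) \<le> \<epsilon>" using bound[OF t] \<mu> by linarith
  qed
qed

section \<open>Prescribing one more derivative\<close>

text \<open>Type \<open>L i\<close> is assigned to the derivative of order \<open>2 i\<close>. The odd orders carry no prescribed type, since
  the correction of one derivative disturbs the velocity of the preceding one. The conditions for
  the first \<open>k\<close> types are required on a whole neighbourhood in the topology of \<open>2 k + 1\<close> derivatives,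
  so that they pass to limits.\<close>

definition close_derivatives :: "nat \<Rightarrow> real \<Rightarrow> (real \<Rightarrow> real^3) \<Rightarrow> (real \<Rightarrow> real^3) \<Rightarrow> bool" where
  "close_derivatives n r f g \<longleftrightarrow> (\<forall>j\<le>n. \<forall>t. norm (nth_derivative j f t - nth_derivative j g t) \<le> r)"

lemma close_derivatives_trans:
  assumes "close_derivatives n r f g" "close_derivatives n s g h" shows "close_derivatives n (r + s) f h"
  unfolding close_derivatives_def
proof (intro allI impI)
  fix j t assume "j \<le> n"
  then show "norm (nth_derivative j f t - nth_derivative j h t) \<le> r + s"
    using assms norm_triangle_ineq[of "nth_derivative j f t - nth_derivative j g t" "nth_derivative j g t - nth_derivative j h t"]
    unfolding close_derivatives_def by (smt (verit) diff_add_cancel add_diff_eq)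
qed

lemma close_derivatives_mono:
  "close_derivatives n r f g \<Longrightarrow> m \<le> n \<Longrightarrow> r \<le> s \<Longrightarrow> close_derivatives m s f g"
  unfolding close_derivatives_def by (meson order_trans)

definition realises :: "(real^3) set \<Rightarrow> (nat \<Rightarrow> (real^3) set) \<Rightarrow> nat \<Rightarrow> (real \<Rightarrow> real^3) \<Rightarrow> bool" where
  "realises K L k f \<longleftrightarrow> (\<forall>j\<le>2 * k. parametrises_a_knot (nth_derivative j f)) \<and>
    ambient_isotopic (range f) K \<and>
    (\<forall>i\<in>{1..k}. ambient_isotopic (range (nth_derivative (2 * i) f)) (L i))"

definition stably_realises :: "(real^3) set \<Rightarrow> (nat \<Rightarrow> (real^3) set) \<Rightarrow> nat \<Rightarrow> real \<Rightarrow> (real \<Rightarrow> real^3) \<Rightarrow> bool" where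
  "stably_realises K L k r f \<longleftrightarrow> smooth_circle_map f \<and> r > 0 \<and>
    (\<forall>h. smooth_circle_map h \<longrightarrow> close_derivatives (2 * k + 1) r h f \<longrightarrow> realises K L k h)"

lemma stably_realises_base:
  assumes "parametrises_a_knot f"
  obtains r where "stably_realises (range f) L 0 r f"
proof -
  obtain r where r: "r > 0"
    "\<And>g. smooth_circle_map g \<Longrightarrow> (\<And>t. norm (velocity g t - velocity f t) \<le> r) \<Longrightarrow>
        parametrises_a_knot g \<and> ambient_isotopic (range g) (range f)"
    using knot_type_stable[OF assms] by blast
  have "realises (range f) L 0 h" if "smooth_circle_map h" "close_derivatives 1 r h f" for h
    using r(2)[OF that(1)] that(2) nth_derivative_Suc[of 0]
    by (auto simp: realises_def close_derivatives_def)
  then show thesis using that[of r] r(1) knot_smooth_circle_map[OF assms] by (simp add: stably_realises_def)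
qed

text \<open>The derivative of order \<open>2 k + 2\<close> is replaced by a knot of type \<open>L (k + 1)\<close> that is close to it
  in the mean. Integrating the difference changes the derivatives up to order \<open>2 k + 1\<close> only
  slightly, which preserves what has been achieved. Here one order is lost: the derivative of order
  \<open>2 k + 1\<close> changes little, but its velocity does not, so that it need not be embedded. A further
  trigonometric perturbation, which is equally small in all derivatives, makes it so.\<close>

lemma stably_realises_step:
  assumes f: "stably_realises K L k r f" and L: "is_knot (L (Suc k))"
  obtains f' r' where "stably_realises K L (Suc k) r' f'" "r' \<le> r / 2" "close_derivatives (2 * k + 1) (r / 2) f' f"
proof -
  have scm: "smooth_circle_map f" and "r > 0"
    and stab: "\<And>h. smooth_circle_map h \<Longrightarrow> close_derivatives (2 * k + 1) r h f \<Longrightarrow> realises K L k h"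
    using f by (auto simp: stably_realises_def)
  obtain l where l: "parametrises_a_knot l" "L (Suc k) = range l" using L by (auto simp: is_knot_def)
  define n where "n = 2 * k + 1"
  define \<gamma> where "\<gamma> = nth_derivative (Suc n) f"
  have \<gamma>: "smooth_circle_map \<gamma>" unfolding \<gamma>_def by (rule smooth_circle_map_nth_derivative[OF scm])
  have scn: "smooth_circle_map (nth_derivative n f)" by (rule smooth_circle_map_nth_derivative[OF scm])
  have "(\<gamma> has_integral (nth_derivative n f (2 * pi) - nth_derivative n f 0)) {0..2 * pi}"
    unfolding \<gamma>_def nth_derivative_Suc
    by (rule fundamental_theorem_of_calculus) (auto intro: smooth_circle_map_has_velocity[OF scn])
  then have mean: "integral {0..2 * pi} \<gamma> = 0"
    using smooth_circle_map_periodic[OF scn, of 0] by (simp add: integral_unique)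
  define \<epsilon> where "\<epsilon> = r / (8 * (4 * pi) ^ n)"
  have \<epsilon>: "\<epsilon> > 0" "2 * (4 * pi) ^ n * \<epsilon> = r / 4" using \<open>r > 0\<close> by (auto simp: \<epsilon>_def)
  obtain \<eta> where \<eta>: "parametrises_a_knot \<eta>" "ambient_isotopic (range \<eta>) (range l)"
    "integral {0..2 * pi} (\<lambda>t. \<eta> t - \<gamma> t) = 0"
    "\<And>t. t \<in> {0..2 * pi} \<Longrightarrow> norm (integral {0..t} (\<lambda>t. \<eta> t - \<gamma> t)) \<le> \<epsilon>"
    using knot_weak_approximation[OF \<gamma> mean l(1) \<epsilon>(1)] by blast
  have sc\<eta>: "smooth_circle_map \<eta>" using \<eta>(1) by (rule knot_smooth_circle_map)
  obtain U where U: "smooth_circle_map U" "nth_derivative (Suc n) U = (\<lambda>t. \<eta> t - \<gamma> t)"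
    "\<And>j t. j \<le> n \<Longrightarrow> norm (nth_derivative j U t) \<le> r / 4"
    using iterated_periodic_antiderivative[OF smooth_circle_map_diff(1)[OF sc\<eta> \<gamma>] \<eta>(3,4), of n]
    unfolding \<epsilon>(2) by blast
  obtain r1 where r1: "r1 > 0"
    "\<And>g. smooth_circle_map g \<Longrightarrow> (\<And>t. norm (velocity g t - velocity \<eta> t) \<le> r1) \<Longrightarrow>
        parametrises_a_knot g \<and> ambient_isotopic (range g) (range \<eta>)"
    using knot_type_stable[OF \<eta>(1)] by blast
  define g where "g = (\<lambda>t. f t + U t)"
  have g: "smooth_circle_map g" and g_der: "nth_derivative j g = (\<lambda>t. nth_derivative j f t + nth_derivative j U t)" for j
    unfolding g_def by (rule smooth_circle_map_add(1)[OF scm U(1)], rule nth_derivative_plus[OF scm U(1)])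
  define e where "e = min (r / 8) (r1 / 2)"
  have "e > 0" using \<open>r > 0\<close> r1(1) by (simp add: e_def)
  obtain a b where ab: "norm a < e" "norm b < e" "parametrises_a_knot (\<lambda>t. nth_derivative n g t + trig a b t)"
    using knot_generic_perturbation[OF smooth_circle_map_nth_derivative[OF g] \<open>e > 0\<close>] by blast
  obtain a' b' where ab': "nth_derivative n (trig a' b') = trig a b" "norm a' + norm b' = norm a + norm b"
    using trig_eq_nth_derivative by blast
  define W where "W = trig a' b'"
  have W: "smooth_circle_map W" "norm (nth_derivative j W t) \<le> r / 4" "norm (nth_derivative j W t) \<le> r1" for j t
    using norm_nth_derivative_trig_le[of j a' b' t] ab' ab(1,2) smooth_circle_map_trig
    by (auto simp: W_def e_def)
  define f' where "f' = (\<lambda>t. g t + W t)"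
  have f': "smooth_circle_map f'" and f'_der: "nth_derivative j f' = (\<lambda>t. nth_derivative j g t + nth_derivative j W t)" for j
    unfolding f'_def by (rule smooth_circle_map_add(1)[OF g W(1)], rule nth_derivative_plus[OF g W(1)])
  have close: "close_derivatives n (r / 2) f' f"
    unfolding close_derivatives_def
  proof (intro allI impI)
    fix j t assume "j \<le> n"
    then show "norm (nth_derivative j f' t - nth_derivative j f t) \<le> r / 2"
      using U(3)[of j t] W(2)[of j t] norm_triangle_ineq[of "nth_derivative j U t" "nth_derivative j W t"]
      by (simp add: f'_der g_der)
  qed
  have knot_n: "parametrises_a_knot (nth_derivative n f')"
    using ab(3) ab'(1) by (simp add: f'_der W_def)
  define h where "h = nth_derivative (Suc n) f'"
  have h: "smooth_circle_map h" unfolding h_def by (rule smooth_circle_map_nth_derivative[OF f'])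
  have h_eq: "h = (\<lambda>t. \<eta> t + nth_derivative (Suc n) W t)"
    unfolding h_def f'_der g_der U(2) by (auto simp: \<gamma>_def)
  have "norm (velocity h t - velocity \<eta> t) \<le> r1" for t
    using W(3)[of "Suc (Suc n)" t] smooth_circle_map_add(2)[OF sc\<eta> smooth_circle_map_nth_derivative[OF W(1), of "Suc n"]]
    by (simp add: h_eq nth_derivative_Suc[of "Suc n"])
  then have knot_h: "parametrises_a_knot h" "ambient_isotopic (range h) (L (Suc k))"
    using r1(2)[OF h] ambient_isotopic_trans \<eta>(2) l(2) by metis+
  obtain r2 where r2: "r2 > 0"
    "\<And>g. smooth_circle_map g \<Longrightarrow> (\<And>t. norm (velocity g t - velocity (nth_derivative n f') t) \<le> r2) \<Longrightarrow>
        parametrises_a_knot g"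
    using knot_C1_open[OF knot_n] by blast
  obtain r3 where r3: "r3 > 0"
    "\<And>g. smooth_circle_map g \<Longrightarrow> (\<And>t. norm (velocity g t - velocity h t) \<le> r3) \<Longrightarrow>
        parametrises_a_knot g \<and> ambient_isotopic (range g) (range h)"
    using knot_type_stable[OF knot_h(1)] by blast
  define r' where "r' = min (r / 2) (min r2 r3)"
  have "realises K L (Suc k) q" if q: "smooth_circle_map q" "close_derivatives (2 * Suc k + 1) r' q f'" for q
  proof -
    have "close_derivatives n (r / 2) q f'"
      using q(2) by (rule close_derivatives_mono) (auto simp: n_def r'_def)
    from close_derivatives_trans[OF this close]
    have old: "realises K L k q" using stab[OF q(1)] by (simp add: n_def)
    have qv: "norm (velocity (nth_derivative j q) t - velocity (nth_derivative j f') t) \<le> r'" if "j \<le> Suc n" for j t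
    proof -
      have "norm (nth_derivative (Suc j) q t - nth_derivative (Suc j) f' t) \<le> r'"
        using q(2) that unfolding close_derivatives_def by (simp add: n_def)
      then show ?thesis by (simp add: nth_derivative_Suc)
    qed
    have 1: "parametrises_a_knot (nth_derivative n q)"
      using qv[of n] by (intro r2(2) smooth_circle_map_nth_derivative q(1)) (auto simp: r'_def)
    have 2: "parametrises_a_knot (nth_derivative (Suc n) q) \<and> ambient_isotopic (range (nth_derivative (Suc n) q)) (range h)"
      using qv[of "Suc n"] by (intro r3(2) smooth_circle_map_nth_derivative q(1)) (auto simp: r'_def h_def)
    have "parametrises_a_knot (nth_derivative j q)" if "j \<le> 2 * Suc k" for j
    proof -
      consider "j \<le> 2 * k" | "j = n" | "j = Suc n" using \<open>j \<le> 2 * Suc k\<close> by (force simp: n_def)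
      then show ?thesis using 1 2 old by cases (auto simp: realises_def)
    qed
    moreover have "ambient_isotopic (range (nth_derivative (2 * i) q)) (L i)" if "i \<in> {1..Suc k}" for i
    proof (cases "i = Suc k")
      case True
      have "2 * Suc k = Suc n" by (simp add: n_def)
      then show ?thesis using True 2 knot_h(2) ambient_isotopic_trans by metis
    qed (use old that in \<open>auto simp: realises_def\<close>)
    ultimately show ?thesis using old by (auto simp: realises_def)
  qed
  then have "stably_realises K L (Suc k) r' f'"
    using f' \<open>r > 0\<close> r2(1) r3(1) by (simp add: stably_realises_def r'_def)
  then show thesis
    using that close by (simp add: n_def r'_def)
qed

section \<open>Limits of smooth loops\<close>

lemma uniform_limit_vector_derivative:
  fixes f :: "nat \<Rightarrow> real \<Rightarrow> real^3"
  assumes f: "\<And>n t. (f n has_vector_derivative f' n t) (at t)"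
    and lim: "\<And>t. (\<lambda>n. f n t) \<longlonglongrightarrow> g t"
    and unif: "uniform_limit UNIV f' g' sequentially"
  shows "(g has_vector_derivative g' t) (at t)"
proof -
  have "\<exists>G. \<forall>x\<in>UNIV. (\<lambda>n. f n x) \<longlonglongrightarrow> G x \<and> (G has_derivative (\<lambda>h. h *\<^sub>R g' x)) (at x within UNIV)"
  proof (rule has_derivative_sequence[where f' = "\<lambda>n x h. h *\<^sub>R f' n x"])
    show "(f n has_derivative (\<lambda>h. h *\<^sub>R f' n x)) (at x within UNIV)" for n x
      using f[of n x] by (simp add: has_vector_derivative_def)
    fix e :: real assume "e > 0"
    from uniform_limitD[OF unif this]
    show "\<forall>\<^sub>F n in sequentially. \<forall>x\<in>UNIV. \<forall>h. norm (h *\<^sub>R f' n x - h *\<^sub>R g' x) \<le> e * norm h"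
    proof eventually_elim
      case (elim n)
      show ?case
      proof (intro ballI allI)
        fix x h
        have "norm (h *\<^sub>R f' n x - h *\<^sub>R g' x) = norm (f' n x - g' x) * norm h"
          by (simp add: scaleR_diff_right[symmetric])
        also have "\<dots> \<le> e * norm h"
          using elim by (intro mult_right_mono) (auto simp: dist_norm less_imp_le)
        finally show "norm (h *\<^sub>R f' n x - h *\<^sub>R g' x) \<le> e * norm h" .
      qed
    qed
  qed (use lim[of 0] in auto)
  then obtain G where G: "\<And>x. (\<lambda>n. f n x) \<longlonglongrightarrow> G x" "\<And>x. (G has_derivative (\<lambda>h. h *\<^sub>R g' x)) (at x)"
    by auto
  have "G = g" using LIMSEQ_unique[OF G(1) lim] by auto
  then show ?thesis using G(2) by (simp add: has_vector_derivative_def)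
qed

text \<open>The radii decrease at least geometrically with ratio \<open>1/2\<close>, so all later steps together move the
  derivatives of \<open>f k\<close> by at most \<open>r k/2 + r k/4 + \<dots> \<le> r k\<close>; in telescoped form, from \<open>k\<close> to \<open>m\<close> by at
  most \<open>r k - r m\<close>.\<close>

lemma limit_of_close_loops:
  assumes f: "\<And>k. smooth_circle_map (f k)" and r: "\<And>k. r k > 0" "\<And>k. r (Suc k) \<le> r k / 2"
    and close: "\<And>k. close_derivatives (2 * k + 1) (r k / 2) (f (Suc k)) (f k)"
  obtains F where "smooth_circle_map F" "\<And>k. close_derivatives (2 * k + 1) (r k) F (f k)"
proof -
  have tel: "close_derivatives (2 * k + 1) (r k - r (k + d)) (f (k + d)) (f k)" for k d
  proof (induction d)
    case 0
    then show ?case by (simp add: close_derivatives_def)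
  next
    case (Suc d)
    have "close_derivatives (2 * k + 1) (r (k + d) / 2) (f (Suc (k + d))) (f (k + d))"
      by (rule close_derivatives_mono[OF close]) auto
    from close_derivatives_trans[OF this Suc] show ?case
      using r(2)[of "k + d"] by (auto elim: close_derivatives_mono)
  qed
  have r_le: "r k \<le> r 0 / 2 ^ k" for k
  proof (induction k)
    case (Suc k)
    then have "r k / 2 \<le> r 0 / 2 ^ k / 2" by (intro divide_right_mono) auto
    then have "r (Suc k) \<le> r 0 / 2 ^ k / 2" using r(2)[of k] by (rule order_trans[rotated])
    then show ?case by (simp add: mult.commute)
  qed simp
  have zero: "(\<lambda>k. r 0 / 2 ^ k) \<longlonglongrightarrow> 0"
    using LIMSEQ_divide_realpow_zero[of 2 "r 0"] by simp
  have r_lim: "r \<longlonglongrightarrow> 0"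
    by (rule tendsto_sandwich[OF _ _ tendsto_const zero]) (auto intro!: always_eventually r_le less_imp_le[OF r(1)])
  have dist: "dist (nth_derivative j (f m) t) (nth_derivative j (f k) t) \<le> r k" if "j \<le> 2 * k + 1" "k \<le> m" for j k m t
    using tel[of k "m - k"] that r(1)[of m] unfolding close_derivatives_def dist_norm
    by (smt (verit, best) le_add_diff_inverse)
  have cauchy: "\<exists>M. \<forall>m\<ge>M. \<forall>n\<ge>M. \<forall>t\<in>UNIV. dist (nth_derivative j (f m) t) (nth_derivative j (f n) t) < e" if "e > 0" for j e
  proof -
    obtain M0 where M0: "\<And>k. k \<ge> M0 \<Longrightarrow> r k < e / 2"
      using order_tendstoD(2)[OF r_lim half_gt_zero[OF \<open>e > 0\<close>]] unfolding eventually_sequentially by blast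
    define M where "M = max M0 j"
    have "dist (nth_derivative j (f m) t) (nth_derivative j (f n) t) < e" if "m \<ge> M" "n \<ge> M" for m n t
    proof -
      have "j \<le> 2 * M + 1" by (simp add: M_def)
      from dist[OF this that(1), of t] dist[OF this that(2), of t]
      have "dist (nth_derivative j (f m) t) (nth_derivative j (f n) t) \<le> r M + r M"
        using dist_triangle2[of "nth_derivative j (f m) t" "nth_derivative j (f n) t" "nth_derivative j (f M) t"] by linarith
      then show ?thesis using M0[of M] by (simp add: M_def)
    qed
    then show ?thesis by blast
  qed
  have "\<exists>G. uniform_limit UNIV (\<lambda>m. nth_derivative j (f m)) G sequentially" for j
  proof -
    have "uniformly_Cauchy_on UNIV (\<lambda>m. nth_derivative j (f m))"
      unfolding uniformly_Cauchy_on_def using cauchy by blast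
    then show ?thesis
      using Cauchy_uniformly_convergent unfolding uniformly_convergent_on_def by blast
  qed
  then obtain G where G: "\<And>j. uniform_limit UNIV (\<lambda>m. nth_derivative j (f m)) (G j) sequentially" by metis
  have G_lim: "(\<lambda>m. nth_derivative j (f m) t) \<longlonglongrightarrow> G j t" for j t
    using tendsto_uniform_limitI[OF G] by blast
  have G_der: "(G j has_vector_derivative G (Suc j) t) (at t)" for j t
  proof (rule uniform_limit_vector_derivative[OF _ G_lim G])
    show "(nth_derivative j (f n) has_vector_derivative nth_derivative (Suc j) (f n) t) (at t)" for n t
      unfolding nth_derivative_Suc
      by (rule smooth_circle_map_has_velocity[OF smooth_circle_map_nth_derivative[OF f]])
  qed
  have "Ck_on k (G j) UNIV" for k j
  proof (induction k arbitrary: j)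
    case 0
    have "isCont (G j) t" for t using has_vector_derivative_continuous[OF G_der] .
    then show ?case by (simp add: continuous_at_imp_continuous_on)
  next
    case (Suc k)
    show ?case
    proof (rule Ck_on_SucI)
      show "(G j has_derivative (\<lambda>v. v *\<^sub>R G (Suc j) t)) (at t)" for t
        using G_der by (simp add: has_vector_derivative_def)
      show "Ck_on k (\<lambda>t. v *\<^sub>R G (Suc j) t) UNIV" for v
        by (intro Ck_on_bilinear[OF bounded_bilinear_scaleR] Ck_on_const Suc) auto
    qed auto
  qed
  moreover have "G 0 (t + 2 * pi) = G 0 t" for t
    using LIMSEQ_unique[OF G_lim[of 0 "t + 2 * pi"]] G_lim[of 0 t] by (simp add: smooth_circle_map_periodic[OF f])
  ultimately have "smooth_circle_map (G 0)" by (simp add: smooth_circle_map_def smooth_on_def)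
  moreover have "nth_derivative j (G 0) = G j" for j
  proof (induction j)
    case (Suc j)
    have "velocity (G j) t = G (Suc j) t" for t
      using G_der by (rule vector_derivative_at)
    then show ?case by (simp add: nth_derivative_Suc Suc)
  qed simp
  moreover have "norm (G j t - nth_derivative j (f k) t) \<le> r k" if "j \<le> 2 * k + 1" for j k t
  proof (rule LIMSEQ_le_const2)
    show "(\<lambda>m. norm (nth_derivative j (f m) t - nth_derivative j (f k) t)) \<longlonglongrightarrow> norm (G j t - nth_derivative j (f k) t)"
      by (intro tendsto_intros G_lim)
    show "\<exists>M. \<forall>m\<ge>M. norm (nth_derivative j (f m) t - nth_derivative j (f k) t) \<le> r k"
      using dist[OF that] by (auto simp: dist_norm)
  qed
  ultimately show thesis using that by (simp add: close_derivatives_def)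
qed

section \<open>Prescribed knot types among the derivatives\<close>

theorem theorem1p3:
  fixes K :: "(real^3) set" and L :: "nat \<Rightarrow> (real^3) set"
  assumes "is_knot K"
    and "\<And>i. i \<ge> 1 \<Longrightarrow> is_knot (L i)"
  shows "\<exists>f :: real \<Rightarrow> real^3.
           smooth_circle_map f \<and>
           parametrises f K \<and>
           (\<forall>n\<ge>1. parametrises_a_knot (nth_derivative n f)) \<and>
           (\<exists>m :: nat \<Rightarrow> nat.
              strict_mono_on {1..} m \<and>
              (\<forall>i\<ge>1. m i \<ge> 1 \<and> ambient_isotopic (range (nth_derivative (m i) f)) (L i)))"
proof -
  obtain f0 where f0: "parametrises_a_knot f0" "K = range f0" using assms(1) by (auto simp: is_knot_def)
  obtain r0 where r0: "stably_realises K L 0 r0 f0"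
    using stably_realises_base[OF f0(1)] f0(2) by metis
  have "\<exists>p. \<forall>k. stably_realises K L k (snd (p k)) (fst (p k)) \<and>
      (snd (p (Suc k)) \<le> snd (p k) / 2 \<and> close_derivatives (2 * k + 1) (snd (p k) / 2) (fst (p (Suc k))) (fst (p k)))"
  proof (rule dependent_nat_choice)
    show "\<exists>q. stably_realises K L 0 (snd q) (fst q)" using r0 by (intro exI[of _ "(f0, r0)"]) simp
    fix q k assume "stably_realises K L k (snd q) (fst q)"
    then obtain f' r' where "stably_realises K L (Suc k) r' f'" "r' \<le> snd q / 2"
        "close_derivatives (2 * k + 1) (snd q / 2) f' (fst q)"
      using stably_realises_step assms(2)[of "Suc k"] by (metis One_nat_def Suc_le_mono le0)
    then show "\<exists>q'. stably_realises K L (Suc k) (snd q') (fst q') \<and>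
        (snd q' \<le> snd q / 2 \<and> close_derivatives (2 * k + 1) (snd q / 2) (fst q') (fst q))"
      by (intro exI[of _ "(f', r')"]) simp
  qed
  then obtain p where p: "\<And>k. stably_realises K L k (snd (p k)) (fst (p k))"
    "\<And>k. snd (p (Suc k)) \<le> snd (p k) / 2"
    "\<And>k. close_derivatives (2 * k + 1) (snd (p k) / 2) (fst (p (Suc k))) (fst (p k))"
    by blast
  obtain F where F: "smooth_circle_map F" "\<And>k. close_derivatives (2 * k + 1) (snd (p k)) F (fst (p k))"
    using limit_of_close_loops[of "\<lambda>k. fst (p k)" "\<lambda>k. snd (p k)"] p by (auto simp: stably_realises_def)
  have real: "realises K L k F" for k
    using p(1)[of k] F by (auto simp: stably_realises_def)
  have "parametrises_a_knot (nth_derivative n F)" for n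
    using real[of n] by (simp add: realises_def)
  moreover have "ambient_isotopic (range F) K" using real[of 0] by (simp add: realises_def)
  moreover have "ambient_isotopic (range (nth_derivative (2 * i) F)) (L i)" if "i \<ge> 1" for i
    using real[of i] that by (simp add: realises_def)
  ultimately show ?thesis
    using F(1) nth_derivative_0[of F]
    by (intro exI[of _ F] conjI exI[of _ "\<lambda>i. 2 * i"])
       (auto simp: parametrises_def strict_mono_on_def simp del: nth_derivative_0, metis)
qed

end
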